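(* Let $G$ be a connected Lie group, let $(\mathrm{g},\sigma)$ be a bi-invariant magnetic system on $G$, and let $s>0$. Then ${\rm Sec}^{(\mathrm{g},\sigma,s)}\geq 0$. Moreover, ${\rm Sec}^{(\mathrm{g},\sigma,s)}=0$ (identically) if and only if $G$ is Abelian and $\sigma=0$.
   Context: A magnetic system on a smooth manifold $M$ is a pair $(\mathrm{g},\sigma)$, where $\mathrm{g}$ is a Riemannian metric on $M$ and $\sigma$ is a closed $2$-form on $M$. Its Lorentz force operator $\mathbf{Y}\colon TM\to TM$ is the skew-adjoint bundle endomorphism characterized by $\sigma_x(v,w)=\mathrm{g}_x(\mathbf{Y}_x(v),w)$ for all $x\in M$, $v,w\in T_xM$. Let $\nabla$ be the Levi-Civita connection of $\mathrm{g}$ and $R^{\mathrm{g}}$ its Riemann curvature tensor, with the sign convention that $\mathrm{g}(R^{\mathrm{g}}(w,v)v,w)$ is the Riemannian sectional curvature of the plane spanned by orthonormal $v,w$. For $x\in M$ and a unit vector $v\in T_xM$, split $T_xM=\mathbb{R}v\oplus v^\perp$ orthogonally and let $(\cdot)^\top$, $(\cdot)^\perp$ denote the orthogonal projections onto $\mathbb{R}v$ and $v^\perp$. For $s>0$ and $w\in v^\perp$ set $$R^{(\mathrm{g},\sigma,s)}_{(x,v)}(w)=s^2R^{\mathrm{g}}_x(w,v)v-s(\nabla_w\mathbf{Y})(v)+\tfrac{s}{2}\big((\nabla_v\mathbf{Y})(w)\big)^\perp,$$ $$A^{(\mathrm{g},\sigma)}_{(x,v)}(w)=-\tfrac34\mathbf{Y}_x\big(\mathbf{Y}_x(w)^\top\big)-\tfrac14\big(\mathbf{Y}_x^2(w)\big)^\perp.$$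 The $s$-magnetic sectional curvature of $(\mathrm{g},\sigma)$ is the function on ordered orthonormal pairs $(v,w)$ of vectors in $T_xM$, $x\in M$, given by $${\rm Sec}^{(\mathrm{g},\sigma,s)}_x(v,w)=\mathrm{g}_x\big(R^{(\mathrm{g},\sigma,s)}_{(x,v)}(w)+A^{(\mathrm{g},\sigma)}_{(x,v)}(w),w\big).$$ "${\rm Sec}^{(\mathrm{g},\sigma,s)}\geq0$" and "${\rm Sec}^{(\mathrm{g},\sigma,s)}=0$" mean that the condition holds for all $x$ and all ordered orthonormal pairs $(v,w)$ in $T_xM$. A magnetic system $(\mathrm{g},\sigma)$ on a Lie group $G$ is left-invariant if all left translations preserve both $\mathrm{g}$ and $\sigma$, and bi-invariant if all left translations and all right translations preserve both $\mathrm{g}$ and $\sigma$. *)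

theory Defs
  imports "HOL-Analysis.Analysis" "HOL-Algebra.Group"
begin

section \<open>Smooth maps between open subsets of vector spaces\<close>

text \<open>These definitions are meant for open sets \<open>S\<close>, where the full filter \<open>at x\<close> is the right one.
  In finite dimension, existence and continuity of all iterated directional derivatives
  is the usual notion of \<open>C\<^sup>k\<close>.\<close>

primrec k_smooth_on ::
  "nat \<Rightarrow> 'a::real_normed_vector set \<Rightarrow> ('a \<Rightarrow> 'b::real_normed_vector) \<Rightarrow> bool" where
  "k_smooth_on 0 S f \<longleftrightarrow> continuous_on S f"
| "k_smooth_on (Suc k) S f \<longleftrightarrow>
     (\<forall>x\<in>S. f differentiable (at x)) \<and>
     (\<forall>v. k_smooth_on k S (\<lambda>x. frechet_derivative f (at x) v))"

definition smooth_on :: "'a::real_normed_vector set \<Rightarrow> ('a \<Rightarrow> 'b::real_normed_vector) \<Rightarrow> bool" where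
  "smooth_on S f \<longleftrightarrow> (\<forall>k. k_smooth_on k S f)"

section \<open>Smooth manifolds\<close>

text \<open>A chart is a domain together with a coordinate map; the values of the coordinate map
  outside the domain are irrelevant.\<close>

type_synonym ('g, 'e) chart = "'g set \<times> ('g \<Rightarrow> 'e)"

abbreviation dom_of :: "('g, 'e) chart \<Rightarrow> 'g set" where
  "dom_of c \<equiv> fst c"

abbreviation crd :: "('g, 'e) chart \<Rightarrow> 'g \<Rightarrow> 'e" where
  "crd c \<equiv> snd c"

definition img_of :: "('g, 'e) chart \<Rightarrow> 'e set" where
  "img_of c = crd c ` dom_of c"

definition chart_inv :: "('g, 'e) chart \<Rightarrow> 'e \<Rightarrow> 'g" where
  "chart_inv c = the_inv_into (dom_of c) (crd c)"

definition local_rep ::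
  "('g, 'e) chart \<Rightarrow> ('h, 'f) chart \<Rightarrow> ('g \<Rightarrow> 'h) \<Rightarrow> 'e \<Rightarrow> 'f" where
  "local_rep c d f = crd d \<circ> f \<circ> chart_inv c"

definition points :: "('g, 'e) chart set \<Rightarrow> 'g set" where
  "points A = (\<Union>c\<in>A. dom_of c)"

text \<open>The model space is a finite-dimensional inner product space rather than an
  \<open>euclidean_space\<close>, because the latter class excludes dimension 0. The atlas need not be
  maximal.\<close>

definition smooth_manifold :: "'g topology \<Rightarrow> ('g, 'e::real_inner) chart set \<Rightarrow> bool" where
  "smooth_manifold T A \<longleftrightarrow>
     (\<exists>B::'e set. finite B \<and> span B = UNIV) \<and>
     Hausdorff_space T \<and> second_countable T \<and>
     points A = topspace T \<and>
     (\<forall>c\<in>A. openin T (dom_of c) \<and> open (img_of c) \<and>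
        homeomorphic_map (subtopology T (dom_of c)) (top_of_set (img_of c)) (crd c)) \<and>
     (\<forall>c\<in>A. \<forall>d\<in>A. smooth_on (crd c ` (dom_of c \<inter> dom_of d)) (local_rep c d id))"

definition smooth_map ::
  "'g topology \<Rightarrow> ('g, 'e::real_inner) chart set \<Rightarrow>
   'h topology \<Rightarrow> ('h, 'f::real_inner) chart set \<Rightarrow> ('g \<Rightarrow> 'h) \<Rightarrow> bool" where
  "smooth_map T A T' A' f \<longleftrightarrow>
     continuous_map T T' f \<and>
     (\<forall>c\<in>A. \<forall>d\<in>A'. smooth_on (crd c ` {x \<in> dom_of c. f x \<in> dom_of d}) (local_rep c d f))"

definition prod_atlas ::
  "('g, 'e) chart set \<Rightarrow> ('h, 'f) chart set \<Rightarrow> ('g \<times> 'h, 'e \<times> 'f) chart set" where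
  "prod_atlas A A' =
     (\<lambda>(c, d). (dom_of c \<times> dom_of d, \<lambda>(x, y). (crd c x, crd d y))) ` (A \<times> A')"

section \<open>Lie groups\<close>

definition lie_group ::
  "('g, 'm) monoid_scheme \<Rightarrow> 'g topology \<Rightarrow> ('g, 'e::real_inner) chart set \<Rightarrow> bool" where
  "lie_group G T A \<longleftrightarrow>
     group G \<and> smooth_manifold T A \<and> topspace T = carrier G \<and>
     smooth_map (prod_topology T T) (prod_atlas A A) T A (\<lambda>(x, y). x \<otimes>\<^bsub>G\<^esub> y) \<and>
     smooth_map T A T A (\<lambda>x. inv\<^bsub>G\<^esub> x)"

section \<open>Tangent vectors\<close>

text \<open>A tangent vector at \<open>x\<close> is the family of its components in all the charts around \<open>x\<close>,
  related by the derivatives of the transition maps (and 0 at all other charts, so that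
  equality of tangent vectors is equality of functions).\<close>

type_synonym ('g, 'e) tvec = "('g, 'e) chart \<Rightarrow> 'e"

definition tangent_space ::
  "('g, 'e::real_inner) chart set \<Rightarrow> 'g \<Rightarrow> ('g, 'e) tvec set" where
  "tangent_space A x =
     {v. (\<forall>c\<in>A. \<forall>d\<in>A. x \<in> dom_of c \<and> x \<in> dom_of d \<longrightarrow>
            v d = frechet_derivative (local_rep c d id) (at (crd c x)) (v c)) \<and>
         (\<forall>c. \<not> (c \<in> A \<and> x \<in> dom_of c) \<longrightarrow> v c = 0)}"

text \<open>The tangent vector at \<open>x\<close> whose components in the chart \<open>c\<close> are \<open>a\<close>.\<close>

definition tangent_vec ::
  "('g, 'e::real_inner) chart set \<Rightarrow> ('g, 'e) chart \<Rightarrow> 'g \<Rightarrow> 'e \<Rightarrow> ('g, 'e) tvec" where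
  "tangent_vec A c x a = (\<lambda>d. if d \<in> A \<and> x \<in> dom_of d
     then frechet_derivative (local_rep c d id) (at (crd c x)) a else 0)"

text \<open>Some chart around \<open>x\<close>; it is only used for constructions that do not depend on the chart.\<close>

definition chart_at :: "('g, 'e) chart set \<Rightarrow> 'g \<Rightarrow> ('g, 'e) chart" where
  "chart_at A x = (SOME c. c \<in> A \<and> x \<in> dom_of c)"

definition pushforward ::
  "('g, 'e::real_inner) chart set \<Rightarrow> ('g \<Rightarrow> 'g) \<Rightarrow> 'g \<Rightarrow> ('g, 'e) tvec \<Rightarrow> ('g, 'e) tvec" where
  "pushforward A f x v = (\<lambda>d. if d \<in> A \<and> f x \<in> dom_of d
     then frechet_derivative (local_rep (chart_at A x) d f) (at (crd (chart_at A x) x))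
            (v (chart_at A x))
     else 0)"

section \<open>Magnetic systems\<close>

text \<open>A covariant 2-tensor field; only its values on points of the manifold and on tangent vectors
  there matter.\<close>

type_synonym ('g, 'e) tensor2 = "'g \<Rightarrow> ('g, 'e) tvec \<Rightarrow> ('g, 'e) tvec \<Rightarrow> real"

definition local_tensor ::
  "('g, 'e::real_inner) chart set \<Rightarrow> ('g, 'e) tensor2 \<Rightarrow> ('g, 'e) chart \<Rightarrow>
   'e \<Rightarrow> 'e \<Rightarrow> 'e \<Rightarrow> real" where
  "local_tensor A t c p a b =
     (let x = chart_inv c p in t x (tangent_vec A c x a) (tangent_vec A c x b))"

definition smooth_tensor :: "('g, 'e::real_inner) chart set \<Rightarrow> ('g, 'e) tensor2 \<Rightarrow> bool" where
  "smooth_tensor A t \<longleftrightarrow>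
     (\<forall>c\<in>A. (\<forall>p\<in>img_of c. bilinear (local_tensor A t c p)) \<and>
            (\<forall>a b. smooth_on (img_of c) (\<lambda>p. local_tensor A t c p a b)))"

definition riemannian_metric :: "('g, 'e::real_inner) chart set \<Rightarrow> ('g, 'e) tensor2 \<Rightarrow> bool" where
  "riemannian_metric A g \<longleftrightarrow>
     smooth_tensor A g \<and>
     (\<forall>x\<in>points A. \<forall>v\<in>tangent_space A x. \<forall>w\<in>tangent_space A x. g x v w = g x w v) \<and>
     (\<forall>x\<in>points A. \<forall>v\<in>tangent_space A x. v \<noteq> (\<lambda>_. 0) \<longrightarrow> g x v v > 0)"

definition two_form :: "('g, 'e::real_inner) chart set \<Rightarrow> ('g, 'e) tensor2 \<Rightarrow> bool" where
  "two_form A \<sigma> \<longleftrightarrow>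
     smooth_tensor A \<sigma> \<and>
     (\<forall>x\<in>points A. \<forall>v\<in>tangent_space A x. \<sigma> x v v = 0)"

text \<open>The components of \<open>d\<sigma>\<close> in a chart are the cyclic sums
  \<open>\<partial>\<^sub>a \<sigma>(b,e) + \<partial>\<^sub>b \<sigma>(e,a) + \<partial>\<^sub>e \<sigma>(a,b)\<close>.\<close>

definition closed_two_form :: "('g, 'e::real_inner) chart set \<Rightarrow> ('g, 'e) tensor2 \<Rightarrow> bool" where
  "closed_two_form A \<sigma> \<longleftrightarrow>
     two_form A \<sigma> \<and>
     (\<forall>c\<in>A. \<forall>p\<in>img_of c. \<forall>a b e.
        frechet_derivative (\<lambda>q. local_tensor A \<sigma> c q b e) (at p) a +
        frechet_derivative (\<lambda>q. local_tensor A \<sigma> c q e a) (at p) b +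
        frechet_derivative (\<lambda>q. local_tensor A \<sigma> c q a b) (at p) e = 0)"

definition magnetic_system ::
  "('g, 'e::real_inner) chart set \<Rightarrow> ('g, 'e) tensor2 \<Rightarrow> ('g, 'e) tensor2 \<Rightarrow> bool" where
  "magnetic_system A g \<sigma> \<longleftrightarrow> riemannian_metric A g \<and> closed_two_form A \<sigma>"

definition preserves ::
  "('g, 'e::real_inner) chart set \<Rightarrow> ('g \<Rightarrow> 'g) \<Rightarrow> ('g, 'e) tensor2 \<Rightarrow> bool" where
  "preserves A f t \<longleftrightarrow>
     (\<forall>x\<in>points A. \<forall>v\<in>tangent_space A x. \<forall>w\<in>tangent_space A x.
        t (f x) (pushforward A f x v) (pushforward A f x w) = t x v w)"

definition bi_invariant ::
  "('g, 'm) monoid_scheme \<Rightarrow> ('g, 'e::real_inner) chart set \<Rightarrow> ('g, 'e) tensor2 \<Rightarrow> bool" where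
  "bi_invariant G A t \<longleftrightarrow>
     (\<forall>h\<in>carrier G. preserves A (\<lambda>x. h \<otimes>\<^bsub>G\<^esub> x) t \<and> preserves A (\<lambda>x. x \<otimes>\<^bsub>G\<^esub> h) t)"

definition bi_invariant_system ::
  "('g, 'm) monoid_scheme \<Rightarrow> ('g, 'e::real_inner) chart set \<Rightarrow>
   ('g, 'e) tensor2 \<Rightarrow> ('g, 'e) tensor2 \<Rightarrow> bool" where
  "bi_invariant_system G A g \<sigma> \<longleftrightarrow> bi_invariant G A g \<and> bi_invariant G A \<sigma>"

section \<open>Riemannian and magnetic geometry in a coordinate domain\<close>

text \<open>Here \<open>h\<close> and \<open>\<tau>\<close> are the component functions of the metric and of the 2-form
  in a chart. The Levi-Civita connection is \<open>\<nabla>\<^sub>a b = \<Gamma>\<^sub>p(a, b)\<close> on constant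
  (that is, coordinate) vector fields; symmetry of \<open>\<Gamma>\<close> is torsion-freeness, and the last clause is
  \<open>a(h(b,c)) = h(\<nabla>\<^sub>a b, c) + h(b, \<nabla>\<^sub>a c)\<close>.\<close>

definition christoffel ::
  "('e::real_inner \<Rightarrow> 'e \<Rightarrow> 'e \<Rightarrow> real) \<Rightarrow> 'e \<Rightarrow> 'e \<Rightarrow> 'e \<Rightarrow> 'e" where
  "christoffel h p = (THE \<Gamma>. bilinear \<Gamma> \<and> (\<forall>a b. \<Gamma> a b = \<Gamma> b a) \<and>
     (\<forall>a b c. frechet_derivative (\<lambda>q. h q b c) (at p) a = h p (\<Gamma> a b) c + h p b (\<Gamma> a c)))"

text \<open>\<open>\<nabla>\<^sub>X V\<close> for vector fields \<open>X\<close>, \<open>V\<close>.\<close>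

definition cov ::
  "('e::real_inner \<Rightarrow> 'e \<Rightarrow> 'e \<Rightarrow> real) \<Rightarrow> ('e \<Rightarrow> 'e) \<Rightarrow> ('e \<Rightarrow> 'e) \<Rightarrow> 'e \<Rightarrow> 'e" where
  "cov h X V p = frechet_derivative V (at p) (X p) + christoffel h p (X p) (V p)"

text \<open>\<open>R(a,b)c = \<nabla>\<^sub>a \<nabla>\<^sub>b c - \<nabla>\<^sub>b \<nabla>\<^sub>a c\<close>; the term
  \<open>\<nabla>\<^bsub>[a,b]\<^esub> c\<close> vanishes because constant fields commute.\<close>

definition curvature ::
  "('e::real_inner \<Rightarrow> 'e \<Rightarrow> 'e \<Rightarrow> real) \<Rightarrow> 'e \<Rightarrow> 'e \<Rightarrow> 'e \<Rightarrow> 'e \<Rightarrow> 'e" where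
  "curvature h p a b c =
     cov h (\<lambda>_. a) (cov h (\<lambda>_. b) (\<lambda>_. c)) p - cov h (\<lambda>_. b) (cov h (\<lambda>_. a) (\<lambda>_. c)) p"

definition lorentz ::
  "('e::real_inner \<Rightarrow> 'e \<Rightarrow> 'e \<Rightarrow> real) \<Rightarrow> ('e \<Rightarrow> 'e \<Rightarrow> 'e \<Rightarrow> real) \<Rightarrow> 'e \<Rightarrow> 'e \<Rightarrow> 'e" where
  "lorentz h \<tau> p = (THE Y. linear Y \<and> (\<forall>a b. \<tau> p a b = h p (Y a) b))"

text \<open>\<open>(\<nabla>\<^sub>a Y)(b) = \<nabla>\<^sub>a (Y b) - Y (\<nabla>\<^sub>a b)\<close>.\<close>

definition cov_lorentz ::
  "('e::real_inner \<Rightarrow> 'e \<Rightarrow> 'e \<Rightarrow> real) \<Rightarrow> ('e \<Rightarrow> 'e \<Rightarrow> 'e \<Rightarrow> real) \<Rightarrow>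
   'e \<Rightarrow> 'e \<Rightarrow> 'e \<Rightarrow> 'e" where
  "cov_lorentz h \<tau> p a b =
     cov h (\<lambda>_. a) (\<lambda>q. lorentz h \<tau> q b) p - lorentz h \<tau> p (cov h (\<lambda>_. a) (\<lambda>_. b) p)"

text \<open>Orthogonal projections onto the line spanned by a unit vector \<open>v\<close> and onto its orthogonal
  complement.\<close>

definition proj_along ::
  "('e::real_inner \<Rightarrow> 'e \<Rightarrow> 'e \<Rightarrow> real) \<Rightarrow> 'e \<Rightarrow> 'e \<Rightarrow> 'e \<Rightarrow> 'e" where
  "proj_along h p v u = h p u v *\<^sub>R v"

definition proj_perp ::
  "('e::real_inner \<Rightarrow> 'e \<Rightarrow> 'e \<Rightarrow> real) \<Rightarrow> 'e \<Rightarrow> 'e \<Rightarrow> 'e \<Rightarrow> 'e" where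
  "proj_perp h p v u = u - proj_along h p v u"

definition magnetic_R ::
  "('e::real_inner \<Rightarrow> 'e \<Rightarrow> 'e \<Rightarrow> real) \<Rightarrow> ('e \<Rightarrow> 'e \<Rightarrow> 'e \<Rightarrow> real) \<Rightarrow> real \<Rightarrow>
   'e \<Rightarrow> 'e \<Rightarrow> 'e \<Rightarrow> 'e" where
  "magnetic_R h \<tau> s p v w =
     s\<^sup>2 *\<^sub>R curvature h p w v v - s *\<^sub>R cov_lorentz h \<tau> p w v
     + (s / 2) *\<^sub>R proj_perp h p v (cov_lorentz h \<tau> p v w)"

definition magnetic_A ::
  "('e::real_inner \<Rightarrow> 'e \<Rightarrow> 'e \<Rightarrow> real) \<Rightarrow> ('e \<Rightarrow> 'e \<Rightarrow> 'e \<Rightarrow> real) \<Rightarrow>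
   'e \<Rightarrow> 'e \<Rightarrow> 'e \<Rightarrow> 'e" where
  "magnetic_A h \<tau> p v w =
     (let Y = lorentz h \<tau> p in
      - (3 / 4) *\<^sub>R Y (proj_along h p v (Y w)) - (1 / 4) *\<^sub>R proj_perp h p v (Y (Y w)))"

section \<open>Magnetic sectional curvature\<close>

definition orthonormal_pair ::
  "('g, 'e::real_inner) chart set \<Rightarrow> ('g, 'e) tensor2 \<Rightarrow> 'g \<Rightarrow>
   ('g, 'e) tvec \<Rightarrow> ('g, 'e) tvec \<Rightarrow> bool" where
  "orthonormal_pair A g x v w \<longleftrightarrow>
     v \<in> tangent_space A x \<and> w \<in> tangent_space A x \<and>
     g x v v = 1 \<and> g x w w = 1 \<and> g x v w = 0"

definition magnetic_sec ::
  "('g, 'e::real_inner) chart set \<Rightarrow> ('g, 'e) tensor2 \<Rightarrow> ('g, 'e) tensor2 \<Rightarrow> real \<Rightarrow> 'g \<Rightarrow>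
   ('g, 'e) tvec \<Rightarrow> ('g, 'e) tvec \<Rightarrow> real" where
  "magnetic_sec A g \<sigma> s x v w =
     (let c = chart_at A x; h = local_tensor A g c; \<tau> = local_tensor A \<sigma> c; p = crd c x
      in h p (magnetic_R h \<tau> s p (v c) (w c) + magnetic_A h \<tau> p (v c) (w c)) (w c))"

end

theory Submission
  imports Defs
begin

text \<open>
  A left-invariant vector field generates right translations, so its flow preserves every
  bi-invariant tensor. Combining this with constancy of the tensor on left-invariant fields shows that
  the adjoint action preserves it infinitesimally (\<open>tensor_killing\<close>, \<open>tensor_ad_invariant\<close>). The Levi-Civita connection is
  therefore \<open>\<nabla>\<^sub>X Y = [X, Y] / 2\<close> on left-invariant fields, and both the metric and the magnetic form are parallel
  (\<open>tensor_parallel\<close>, \<open>christoffel_eq_\<Gamma>\<close>). Then \<open>\<nabla>Y = 0\<close>, the curvature is a combination of double brackets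
  (\<open>curvature_left_fields\<close>), and for orthonormal \<open>v\<close>, \<open>w\<close> the magnetic sectional curvature is a sum of squares
  (\<open>magnetic_sectional_curvature\<close>):
  \<open>s\<^sup>2 / 4 * |[v, w]|\<^sup>2 + 3 / 4 * \<sigma>(v, w)\<^sup>2 + 1 / 4 * |Y w|\<^sup>2\<close>.

  It is thus nonnegative, and it vanishes identically if and only if the Lie bracket and \<open>\<sigma>\<close> vanish; in
  dimension at most 1, where there are no orthonormal pairs, both are zero because they are alternating
  (\<open>alternating_zero_if_zero_on_orthonormal\<close>).

  What remains is that a connected group with zero bracket and a bi-invariant metric is commutative. The
  numbers \<open>g(a, Ad b)\<close> have zero derivative, so the adjoint action is trivial and left-invariant fields are
  right-invariant (\<open>bracket_zero_imp_fields_agree\<close>). Differentiating \<open>w F(x w) = F(x) w\<close> for \<open>F x = x\<^sup>-\<^sup>1 k x\<close> then shows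
  that \<open>F\<close> is constant (\<open>bracket_zero_imp_commutative\<close>). Conversely, in a commutative group the invariant
  fields on both sides agree, so their brackets vanish.

  All computations at a point \<open>x\<close> take place in a chart around \<open>x\<close>, so no transformation law for
  connection or curvature is needed. The group enters through the multiplication \<open>(q, w) \<mapsto> q w\<close> with \<open>q\<close> in that chart and
  \<open>w\<close> in a fixed chart around the identity: its derivative with respect to \<open>w\<close> is the left-invariant frame, and
  differentiating the associative law once or twice yields that left and right fields commute and that the
  left fields close under the bracket (\<open>fields_commute\<close>, \<open>left_fields_bracket\<close>).
\<close>

section \<open>Calculus on finite-dimensional inner product spaces\<close>

text \<open>Orthogonalising a spanning set may produce zero vectors. They do no harm: the coefficient
  \<open>(x \<bullet> b) / (b \<bullet> b)\<close> is then \<open>0 / 0 = 0\<close>, so the coordinate functions need no case distinction.\<close>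

lemma bounded_linear_coordinates:
  fixes B :: "'e::real_inner set"
  assumes "finite B" "span B = UNIV"
  obtains C :: "'e set" and \<phi> :: "'e \<Rightarrow> 'e \<Rightarrow> real"
  where "finite C" "\<And>b. bounded_linear (\<phi> b)" "\<And>x. x = (\<Sum>b\<in>C. \<phi> b x *\<^sub>R b)"
proof -
  obtain C :: "'e set" where C: "finite C" "span C = UNIV" "pairwise orthogonal C"
    using basis_orthogonal[OF assms(1)] unfolding assms(2) by blast
  define \<phi> :: "'e \<Rightarrow> 'e \<Rightarrow> real" where "\<phi> = (\<lambda>b x. (x \<bullet> b) / (b \<bullet> b))"
  have "bounded_linear (\<phi> b)" for b
    unfolding \<phi>_def by (rule bounded_linear_compose[OF bounded_linear_divide bounded_linear_inner_left])
  moreover have "x = (\<Sum>b\<in>C. \<phi> b x *\<^sub>R b)" for x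
  proof -
    obtain u where u: "x = (\<Sum>b\<in>C. u b *\<^sub>R b)"
      using C(1,2) span_finite[OF C(1)] by (metis (no_types, lifting) UNIV_I image_iff)
    have "x \<bullet> b = u b * (b \<bullet> b)" if "b \<in> C" for b
    proof -
      have "x \<bullet> b = (\<Sum>c\<in>C. u c * (c \<bullet> b))"
        by (simp add: u inner_sum_left)
      also have "\<dots> = (\<Sum>c\<in>C. if c = b then u b * (b \<bullet> b) else 0)"
        using C(3) that by (intro sum.cong) (auto simp: pairwise_def orthogonal_def)
      finally show ?thesis using C(1) that by simp
    qed
    then have "\<phi> b x *\<^sub>R b = u b *\<^sub>R b" if "b \<in> C" for b
      using that by (cases "b = 0") (auto simp: \<phi>_def)
    then show ?thesis by (metis (no_types, lifting) sum.cong u)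
  qed
  ultimately show thesis using that C(1) by blast
qed

text \<open>The product rule for a family of linear maps applied to a moving vector. Finite dimension enters
  through coordinates: differentiability of \<open>q \<mapsto> F q a\<close> for each single \<open>a\<close> is then enough, and no operator
  norm is involved.\<close>

lemma has_derivative_linear_family:
  fixes F :: "'a::real_normed_vector \<Rightarrow> 'e::real_inner \<Rightarrow> 'b::real_normed_vector"
  assumes "finite B" "span B = (UNIV :: 'e set)"
    and lin: "\<And>q. q \<in> U \<Longrightarrow> linear (F q)" and U: "open U" "p \<in> U"
    and F: "\<And>a. ((\<lambda>q. F q a) has_derivative F' a) (at p)"
    and V: "(V has_derivative V') (at p)"
  shows "((\<lambda>q. F q (V q)) has_derivative (\<lambda>v. F' (V p) v + F p (V' v))) (at p)"
proof -
  obtain C :: "'e set" and \<phi> where C: "finite C" and \<phi>: "\<And>b. bounded_linear (\<phi> b)"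
    and exp: "\<And>x. x = (\<Sum>b\<in>C. \<phi> b x *\<^sub>R b)"
    using bounded_linear_coordinates[OF assms(1,2)] by metis
  have Fexp: "F q x = (\<Sum>b\<in>C. \<phi> b x *\<^sub>R F q b)" if "q \<in> U" for q x
  proof -
    interpret linear "F q" using lin that by blast
    show ?thesis by (subst exp) (simp add: sum scaleR)
  qed
  have const: "F' x = (\<lambda>v. \<Sum>b\<in>C. \<phi> b x *\<^sub>R F' b v)" for x
  proof -
    have "((\<lambda>q. \<Sum>b\<in>C. \<phi> b x *\<^sub>R F q b) has_derivative (\<lambda>v. \<Sum>b\<in>C. \<phi> b x *\<^sub>R F' b v)) (at p)"
      by (intro derivative_intros F)
    then have "((\<lambda>q. F q x) has_derivative (\<lambda>v. \<Sum>b\<in>C. \<phi> b x *\<^sub>R F' b v)) (at p)"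
      by (rule has_derivative_transform_within_open[OF _ U]) (metis Fexp)
    then show ?thesis using F has_derivative_unique by blast
  qed
  have "((\<lambda>q. \<Sum>b\<in>C. \<phi> b (V q) *\<^sub>R F q b) has_derivative
          (\<lambda>v. \<Sum>b\<in>C. \<phi> b (V p) *\<^sub>R F' b v + \<phi> b (V' v) *\<^sub>R F p b)) (at p)"
    by (intro derivative_intros F bounded_linear.has_derivative[OF \<phi>] V)
  also have "(\<lambda>v. \<Sum>b\<in>C. \<phi> b (V p) *\<^sub>R F' b v + \<phi> b (V' v) *\<^sub>R F p b)
      = (\<lambda>v. F' (V p) v + F p (V' v))"
  proof
    fix v
    show "(\<Sum>b\<in>C. \<phi> b (V p) *\<^sub>R F' b v + \<phi> b (V' v) *\<^sub>R F p b) = F' (V p) v + F p (V' v)"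
      using fun_cong[OF const[of "V p"], of v] Fexp[OF U(2), of "V' v"] by (simp add: sum.distrib)
  qed
  finally show ?thesis
    by (rule has_derivative_transform_within_open[OF _ U]) (metis Fexp)
qed

text \<open>Gram-Schmidt for an arbitrary positive definite form instead of the inner product of the space; it will
  be applied to the metric at the identity.\<close>

lemma orthonormal_spanning_set:
  fixes B :: "'e::real_vector set"
  assumes "finite B" and bil: "bilinear h" and sym: "\<And>a b. h a b = h b a"
    and pos: "\<And>a. a \<noteq> 0 \<Longrightarrow> h a a > (0::real)"
  shows "\<exists>C. finite C \<and> span C = span B \<and> (\<forall>c\<in>C. \<forall>d\<in>C. h c d = (if c = d then 1 else 0))"
  using assms(1)
proof induction
  case empty
  then show ?case by (intro exI[of _ "{}"]) simp
next
  case (insert a B)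
  obtain C where C: "finite C" "span C = span B"
    and on: "\<And>c d. c \<in> C \<Longrightarrow> d \<in> C \<Longrightarrow> h c d = (if c = d then 1 else 0)"
    using insert.IH by blast
  interpret hr: linear "h x" for x using bil by (simp add: bilinear_def)
  interpret hl: linear "\<lambda>y. h y x" for x using bil by (simp add: bilinear_def)
  define r where "r = a - (\<Sum>c\<in>C. h a c *\<^sub>R c)"
  have S: "(\<Sum>c\<in>C. h a c *\<^sub>R c) \<in> span B"
    unfolding C(2)[symmetric] by (intro span_sum span_scale span_base)
  have orth: "h r d = 0" if "d \<in> C" for d
  proof -
    have "h (\<Sum>c\<in>C. h a c *\<^sub>R c) d = (\<Sum>c\<in>C. h a c * h c d)"
      by (simp add: hl.sum hl.scale)
    also have "\<dots> = (\<Sum>c\<in>C. if c = d then h a d else 0)"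
      by (intro sum.cong) (auto simp: on that)
    finally show ?thesis using that C(1) by (simp add: r_def hl.diff)
  qed
  show ?case
  proof (cases "r = 0")
    case True
    then have "a \<in> span B" using S by (simp add: r_def)
    then have "span (insert a B) = span B" by (rule span_redundant)
    then show ?thesis using C on by (intro exI[of _ C]) simp
  next
    case False
    define t where "t = (1 / sqrt (h r r)) *\<^sub>R r"
    have tt: "h t t = 1"
      using pos[OF False] by (simp add: t_def hl.scale hr.scale field_simps)
    have th: "h t d = 0" "h d t = 0" if "d \<in> C" for d
      using orth[OF that] sym[of d] by (simp_all add: t_def hl.scale)
    have k: "1 / sqrt (h r r) \<noteq> 0" using pos[OF False] by simp
    have "span (insert t C) = span (insert a B)"
    proof -
      have "x - k *\<^sub>R r \<in> span C \<longleftrightarrow> x - k *\<^sub>R a \<in> span C" for x k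
        unfolding r_def using S C(2)
        by (simp add: scaleR_diff_right diff_diff_eq2 add.commute[of x] add_diff_eq[symmetric] span_add_eq span_scale)
      then have 1: "span (insert r C) = span (insert a C)"
        by (simp add: span_insert)
      have "x \<in> span (insert t C) \<longleftrightarrow> x \<in> span (insert r C)" for x
      proof
        assume "x \<in> span (insert t C)"
        then show "x \<in> span (insert r C)"
          by (auto simp: span_insert t_def)
      next
        assume "x \<in> span (insert r C)"
        then obtain k' where k': "x - k' *\<^sub>R r \<in> span C" by (auto simp: span_insert)
        have "x - (k' * sqrt (h r r)) *\<^sub>R t \<in> span C"
          using k' pos[OF False] by (simp add: t_def)
        then show "x \<in> span (insert t C)" by (auto simp: span_insert)
      qed
      then have "span (insert t C) = span (insert a C)" using 1 by blast
      also have "\<dots> = span (insert a B)" using C(2) by (simp add: span_insert)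
      finally show ?thesis .
    qed
    moreover have "\<forall>c\<in>insert t C. \<forall>d\<in>insert t C. h c d = (if c = d then 1 else 0)"
      using tt th on by (metis insert_iff zero_neq_one)
    ultimately show ?thesis using C(1) by blast
  qed
qed

lemma linear_inj_imp_surj_finite_span:
  fixes f :: "'e::real_vector \<Rightarrow> 'e"
  assumes "linear f" "inj f" "finite B" "span B = (UNIV :: 'e set)"
  shows "surj f"
proof -
  obtain C where C: "C \<subseteq> B" "independent C" "span C = UNIV"
    using maximal_independent_subset[of B] assms(4)
    by (metis UNIV_eq_I UNIV_I span_mono span_span subset_antisym top_greatest)
  interpret finite_dimensional_vector_space "scaleR :: real \<Rightarrow> 'e \<Rightarrow> 'e" C
    using C finite_subset[OF C(1) assms(3)]
    by unfold_locales (auto simp: dependent_raw_def span_raw_def)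
  show ?thesis using linear_inj_imp_surj assms(1,2) by (simp add: linear_def)
qed

text \<open>Schwarz's theorem. By the mean value theorem, applied twice in either order, the second difference of
  \<open>f\<close> over a small parallelogram of side \<open>r\<close> equals \<open>r\<^sup>2\<close> times a value of one mixed derivative near \<open>x\<close> and also \<open>r\<^sup>2\<close>
  times a value of the other. If the two differed at \<open>x\<close>, continuity would separate these values.\<close>

lemma mixed_partials_equal_real:
  fixes f :: "'a::real_normed_vector \<Rightarrow> real"
  assumes S: "open S" "x \<in> S"
    and fv: "\<And>y. y \<in> S \<Longrightarrow> ((\<lambda>t. f (y + t *\<^sub>R v)) has_real_derivative fv y) (at 0)"
    and fw: "\<And>y. y \<in> S \<Longrightarrow> ((\<lambda>t. f (y + t *\<^sub>R w)) has_real_derivative fw y) (at 0)"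
    and fvw: "\<And>y. y \<in> S \<Longrightarrow> ((\<lambda>t. fv (y + t *\<^sub>R w)) has_real_derivative fvw y) (at 0)"
    and fwv: "\<And>y. y \<in> S \<Longrightarrow> ((\<lambda>t. fw (y + t *\<^sub>R v)) has_real_derivative fwv y) (at 0)"
    and cont: "continuous_on S fvw" "continuous_on S fwv"
  shows "fvw x = fwv x"
proof (rule ccontr)
  assume ne: "fvw x \<noteq> fwv x"
  define e where "e = \<bar>fvw x - fwv x\<bar> / 2"
  have e: "e > 0" using ne by (simp add: e_def)
  have line: "((\<lambda>t. g (y + t *\<^sub>R u)) has_real_derivative g' (y + t *\<^sub>R u)) (at t)"
    if g: "\<And>y. y \<in> S \<Longrightarrow> ((\<lambda>t. g (y + t *\<^sub>R u)) has_real_derivative g' y) (at 0)"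
      and "y + t *\<^sub>R u \<in> S" for g g' :: "'a \<Rightarrow> real" and y u t
  proof -
    have "((\<lambda>r. g ((y + t *\<^sub>R u) + r *\<^sub>R u)) has_real_derivative g' (y + t *\<^sub>R u)) (at (t + -t))"
      using g[OF that(2)] by simp
    then have "((\<lambda>r. g ((y + t *\<^sub>R u) + (r + -t) *\<^sub>R u)) has_real_derivative g' (y + t *\<^sub>R u)) (at t)"
      by (subst (asm) DERIV_shift)
    then show ?thesis by (simp add: algebra_simps)
  qed
  obtain d where d: "d > 0" "\<And>y. dist y x < d \<Longrightarrow> y \<in> S \<and> \<bar>fvw y - fvw x\<bar> < e \<and> \<bar>fwv y - fwv x\<bar> < e"
  proof -
    have "isCont fvw x" "isCont fwv x"
      using cont S by (simp_all add: continuous_on_eq_continuous_at)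
    then have "(fvw \<longlongrightarrow> fvw x) (nhds x)" "(fwv \<longlongrightarrow> fwv x) (nhds x)"
      by (simp_all add: isCont_def tendsto_at_iff_tendsto_nhds)
    then have "eventually (\<lambda>y. dist (fvw y) (fvw x) < e) (nhds x)"
      "eventually (\<lambda>y. dist (fwv y) (fwv x) < e) (nhds x)"
      using tendstoD e by blast+
    moreover have "eventually (\<lambda>y. y \<in> S) (nhds x)" using S by (rule eventually_nhds_in_open)
    ultimately have "eventually (\<lambda>y. y \<in> S \<and> \<bar>fvw y - fvw x\<bar> < e \<and> \<bar>fwv y - fwv x\<bar> < e) (nhds x)"
      by eventually_elim (auto simp: dist_real_def)
    then show ?thesis using that by (auto simp: eventually_nhds_metric)
  qed
  \<comment> \<open>Side of the parallelogram, chosen so that all of it lies within distance \<open>d\<close> of \<open>x\<close>.\<close>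
  define r where "r = d / (2 * (norm v + norm w + 1))"
  have nn: "norm v + norm w + 1 > 0" by (smt (verit) norm_ge_zero)
  have r: "r > 0" using d nn by (simp add: r_def)
  have near: "dist (x + s *\<^sub>R v + t *\<^sub>R w) x < d" if "0 \<le> s" "s \<le> r" "0 \<le> t" "t \<le> r" for s t
  proof -
    have "dist (x + s *\<^sub>R v + t *\<^sub>R w) x \<le> s * norm v + t * norm w"
      using norm_triangle_ineq[of "s *\<^sub>R v" "t *\<^sub>R w"] that by (simp add: dist_norm add.assoc)
    also have "\<dots> \<le> r * (norm v + norm w + 1)"
      using that r by (simp add: distrib_left mult_right_mono add_mono add_increasing2)
    also have "\<dots> = d / 2" using nn unfolding r_def by (subst times_divide_eq_left, subst nonzero_mult_divide_mult_cancel_right) simp_all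
    also have "\<dots> < d" using d by simp
    finally show ?thesis .
  qed
  have inS: "x + s *\<^sub>R v + t *\<^sub>R w \<in> S" if "0 \<le> s" "s \<le> r" "0 \<le> t" "t \<le> r" for s t
    using d(2) near that by blast
  have mixed: "\<exists>s t. 0 \<le> s \<and> s \<le> r \<and> 0 \<le> t \<and> t \<le> r \<and>
      f (x + r *\<^sub>R a + r *\<^sub>R b) - f (x + r *\<^sub>R a) - (f (x + r *\<^sub>R b) - f x)
        = r * (r * fab (x + s *\<^sub>R a + t *\<^sub>R b))"
    if fa: "\<And>y. y \<in> S \<Longrightarrow> ((\<lambda>t. f (y + t *\<^sub>R a)) has_real_derivative fa y) (at 0)"
      and fab: "\<And>y. y \<in> S \<Longrightarrow> ((\<lambda>t. fa (y + t *\<^sub>R b)) has_real_derivative fab y) (at 0)"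
      and inS: "\<And>s t. 0 \<le> s \<Longrightarrow> s \<le> r \<Longrightarrow> 0 \<le> t \<Longrightarrow> t \<le> r \<Longrightarrow> x + s *\<^sub>R a + t *\<^sub>R b \<in> S"
    for a b fa fab
  proof -
    \<comment> \<open>The second difference is the increment over \<open>[0, r]\<close> of the difference in direction \<open>b\<close>.\<close>
    define k where "k = (\<lambda>s. f ((x + r *\<^sub>R b) + s *\<^sub>R a) - f (x + s *\<^sub>R a))"
    have "DERIV k s :> fa ((x + r *\<^sub>R b) + s *\<^sub>R a) - fa (x + s *\<^sub>R a)" if "0 \<le> s" "s \<le> r" for s
      unfolding k_def using inS[OF that, of 0] inS[OF that, of r] r
      by (intro DERIV_diff line[where g = f, OF fa]) (simp_all add: algebra_simps)
    then obtain s where s: "0 < s" "s < r"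
      and ks: "k r - k 0 = (r - 0) * (fa ((x + r *\<^sub>R b) + s *\<^sub>R a) - fa (x + s *\<^sub>R a))"
      using MVT2[OF r, of k "\<lambda>s. fa ((x + r *\<^sub>R b) + s *\<^sub>R a) - fa (x + s *\<^sub>R a)"] by metis
    define l where "l = (\<lambda>t. fa ((x + s *\<^sub>R a) + t *\<^sub>R b))"
    have "DERIV l t :> fab ((x + s *\<^sub>R a) + t *\<^sub>R b)" if "0 \<le> t" "t \<le> r" for t
      unfolding l_def using inS[of s t] that s
      by (intro line[where g = fa, OF fab]) simp_all
    then obtain t where t: "0 < t" "t < r"
      and lt: "l r - l 0 = (r - 0) * fab ((x + s *\<^sub>R a) + t *\<^sub>R b)"
      using MVT2[OF r, of l "\<lambda>t. fab ((x + s *\<^sub>R a) + t *\<^sub>R b)"] by metis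
    have "k r - k 0 = r * (r * fab (x + s *\<^sub>R a + t *\<^sub>R b))"
      using ks lt by (simp add: l_def algebra_simps)
    then show ?thesis using s t
      by (intro exI[of _ s] exI[of _ t]) (simp add: k_def algebra_simps)
  qed
  obtain s t where st: "0 \<le> s" "s \<le> r" "0 \<le> t" "t \<le> r"
    and 1: "f (x + r *\<^sub>R v + r *\<^sub>R w) - f (x + r *\<^sub>R v) - (f (x + r *\<^sub>R w) - f x)
        = r * (r * fvw (x + s *\<^sub>R v + t *\<^sub>R w))"
    using mixed[OF fv fvw inS] by blast
  have inS': "x + s *\<^sub>R w + t *\<^sub>R v \<in> S" if "0 \<le> s" "s \<le> r" "0 \<le> t" "t \<le> r" for s t
    using inS[of t s] that by (simp add: algebra_simps)
  obtain s' t' where st': "0 \<le> s'" "s' \<le> r" "0 \<le> t'" "t' \<le> r"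
    and 2: "f (x + r *\<^sub>R w + r *\<^sub>R v) - f (x + r *\<^sub>R w) - (f (x + r *\<^sub>R v) - f x)
        = r * (r * fwv (x + s' *\<^sub>R w + t' *\<^sub>R v))"
    using mixed[OF fw fwv inS'] by blast
  have "r * (r * fvw (x + s *\<^sub>R v + t *\<^sub>R w)) = r * (r * fwv (x + s' *\<^sub>R w + t' *\<^sub>R v))"
    using 1 2 by (simp add: algebra_simps)
  then have eq: "fvw (x + s *\<^sub>R v + t *\<^sub>R w) = fwv (x + s' *\<^sub>R w + t' *\<^sub>R v)"
    using r by simp
  have "\<bar>fvw (x + s *\<^sub>R v + t *\<^sub>R w) - fvw x\<bar> < e" using d(2)[OF near] st by blast
  moreover have "\<bar>fwv (x + s' *\<^sub>R w + t' *\<^sub>R v) - fwv x\<bar> < e"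
    using d(2)[OF near[of t' s']] st' by (simp add: algebra_simps)
  ultimately show False using eq unfolding e_def by (smt (verit) field_sum_of_halves)
qed

lemma k_smooth_on_Suc_has_derivative:
  "k_smooth_on (Suc k) S f \<Longrightarrow> x \<in> S \<Longrightarrow> (f has_derivative frechet_derivative f (at x)) (at x)"
  by (simp add: frechet_derivative_works[symmetric])

text \<open>Pairing with a fixed vector \<open>z\<close> of the target reduces this to real-valued functions on lines.\<close>

lemma second_derivative_symmetric:
  fixes f :: "'a::real_normed_vector \<Rightarrow> 'b::real_inner"
  assumes f: "k_smooth_on 2 S f" and S: "open S" "x \<in> S"
  shows "frechet_derivative (\<lambda>y. frechet_derivative f (at y) v) (at x) w
       = frechet_derivative (\<lambda>y. frechet_derivative f (at y) w) (at x) v"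
proof (rule vector_eq_ldot[THEN iffD1, rule_format])
  fix z :: 'b
  let ?D = "\<lambda>y v. frechet_derivative f (at y) v"
  let ?D2 = "\<lambda>y v w. frechet_derivative (\<lambda>y. ?D y v) (at y) w"
  have sm: "k_smooth_on (Suc (Suc 0)) S f" using f by (simp add: numeral_2_eq_2)
  have d1: "(f has_derivative ?D y) (at y)" if "y \<in> S" for y
    using k_smooth_on_Suc_has_derivative[OF sm that] .
  have d2: "((\<lambda>y. ?D y v) has_derivative ?D2 y v) (at y)" if "y \<in> S" for y v
    using sm that by (intro k_smooth_on_Suc_has_derivative[of 0 S]) auto
  have c2: "continuous_on S (\<lambda>y. ?D2 y v w)" for v w using sm by simp
  have dir: "((\<lambda>t. z \<bullet> g (y + t *\<^sub>R u)) has_real_derivative z \<bullet> g' u) (at 0)"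
    if "(g has_derivative g') (at y)" for g :: "'a \<Rightarrow> 'b" and g' y u
  proof -
    have "((\<lambda>t. y + t *\<^sub>R u) has_derivative (\<lambda>t. t *\<^sub>R u)) (at 0)"
      by (auto intro!: derivative_eq_intros)
    from diff_chain_at[OF this, of g g'] that
    have "((\<lambda>t. g (y + t *\<^sub>R u)) has_derivative (\<lambda>t. g' (t *\<^sub>R u))) (at 0)"
      by (simp add: o_def)
    then have "((\<lambda>t. z \<bullet> g (y + t *\<^sub>R u)) has_derivative (\<lambda>t. z \<bullet> g' (t *\<^sub>R u))) (at 0)"
      by (rule has_derivative_inner_right)
    moreover have "(\<lambda>t. z \<bullet> g' (t *\<^sub>R u)) = (*) (z \<bullet> g' u)"
      using linear_scale[OF has_derivative_linear[OF that]] by (auto simp: mult.commute)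
    ultimately show ?thesis by (simp add: has_field_derivative_def)
  qed
  show "z \<bullet> ?D2 x v w = z \<bullet> ?D2 x w v"
    by (rule mixed_partials_equal_real[OF S, where f = "\<lambda>y. z \<bullet> f y" and v = v and w = w
          and fv = "\<lambda>y. z \<bullet> ?D y v" and fw = "\<lambda>y. z \<bullet> ?D y w"])
      (auto intro!: dir d1 d2 continuous_intros c2)
qed

lemma has_derivative_bilinear_family:
  fixes t :: "'a::real_normed_vector \<Rightarrow> 'e::real_inner \<Rightarrow> 'e \<Rightarrow> 'b::real_normed_vector"
  assumes "finite B" "span B = (UNIV :: 'e set)"
    and bil: "\<And>q. q \<in> U \<Longrightarrow> bilinear (t q)" and U: "open U" "p \<in> U"
    and t: "\<And>a b. ((\<lambda>q. t q a b) has_derivative t' a b) (at p)"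
    and V: "(V has_derivative V') (at p)" and W: "(W has_derivative W') (at p)"
  shows "((\<lambda>q. t q (V q) (W q)) has_derivative
    (\<lambda>v. t' (V p) (W p) v + t p (V' v) (W p) + t p (V p) (W' v))) (at p)"
proof -
  have 1: "((\<lambda>q. t q a (W q)) has_derivative (\<lambda>v. t' a (W p) v + t p a (W' v))) (at p)" for a
    using bil by (intro has_derivative_linear_family[OF assms(1,2) _ U t W]) (simp add: bilinear_def)
  have "((\<lambda>q. t q (V q) (W q)) has_derivative
      (\<lambda>v. (t' (V p) (W p) v + t p (V p) (W' v)) + t p (V' v) (W p))) (at p)"
    using bil
    by (intro has_derivative_linear_family[where F = "\<lambda>q a. t q a (W q)", OF assms(1,2) _ U 1 V])
      (simp add: bilinear_def)
  then show ?thesis by (simp add: algebra_simps)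
qed

lemma linear_frechet_derivative_family:
  fixes F :: "'a::real_normed_vector \<Rightarrow> 'e::real_vector \<Rightarrow> 'b::real_normed_vector"
  assumes lin: "\<And>q. q \<in> U \<Longrightarrow> linear (F q)" and U: "open U" "p \<in> U"
    and F: "\<And>a. (\<lambda>q. F q a) differentiable (at p)"
  shows "linear (\<lambda>a. frechet_derivative (\<lambda>q. F q a) (at p) v)"
proof
  have d: "((\<lambda>q. F q a) has_derivative frechet_derivative (\<lambda>q. F q a) (at p)) (at p)" for a
    using F frechet_derivative_works by blast
  fix a b :: 'e and r :: real
  have "((\<lambda>q. F q (a + b)) has_derivative
      (\<lambda>v. frechet_derivative (\<lambda>q. F q a) (at p) v + frechet_derivative (\<lambda>q. F q b) (at p) v)) (at p)"
    by (rule has_derivative_transform_within_open[OF has_derivative_add[OF d d] U])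
      (simp add: linear_add[OF lin])
  then show "frechet_derivative (\<lambda>q. F q (a + b)) (at p) v =
      frechet_derivative (\<lambda>q. F q a) (at p) v + frechet_derivative (\<lambda>q. F q b) (at p) v"
    by (metis frechet_derivative_at)
  have "((\<lambda>q. F q (r *\<^sub>R a)) has_derivative
      (\<lambda>v. r *\<^sub>R frechet_derivative (\<lambda>q. F q a) (at p) v)) (at p)"
    by (rule has_derivative_transform_within_open[OF has_derivative_scaleR_right[OF d] U])
      (simp add: linear_scale[OF lin])
  then show "frechet_derivative (\<lambda>q. F q (r *\<^sub>R a)) (at p) v =
      r *\<^sub>R frechet_derivative (\<lambda>q. F q a) (at p) v"
    by (metis frechet_derivative_at)
qed

lemma has_derivative_slices:
  assumes "(f has_derivative f') (at (x, y))"
  shows "((\<lambda>x. f (x, y)) has_derivative (\<lambda>v. f' (v, 0))) (at x)"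
    "((\<lambda>y. f (x, y)) has_derivative (\<lambda>v. f' (0, v))) (at y)"
proof -
  have "((\<lambda>x. (x, y)) has_derivative (\<lambda>v. (v, 0))) (at x)" "((\<lambda>y. (x, y)) has_derivative (\<lambda>v. (0, v))) (at y)"
    by (intro derivative_intros)+
  from this[THEN diff_chain_at, of f f'] assms
  show "((\<lambda>x. f (x, y)) has_derivative (\<lambda>v. f' (v, 0))) (at x)"
    "((\<lambda>y. f (x, y)) has_derivative (\<lambda>v. f' (0, v))) (at y)"
    by (simp_all add: o_def)
qed

lemma k_smooth_on_cong:
  assumes "open S" "\<And>x. x \<in> S \<Longrightarrow> f x = g x" "k_smooth_on k S f"
  shows "k_smooth_on k S g"
  using assms(2,3)
proof (induction k arbitrary: f g)
  case 0
  then show ?case by (simp cong: continuous_on_cong)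
next
  case (Suc k)
  have d: "(g has_derivative frechet_derivative f (at x)) (at x)" if "x \<in> S" for x
    by (rule has_derivative_transform_within_open[OF k_smooth_on_Suc_has_derivative[OF Suc.prems(2) that]
          assms(1) that Suc.prems(1)])
  have "k_smooth_on k S (\<lambda>x. frechet_derivative g (at x) v)" for v
  proof (rule Suc.IH)
    show "frechet_derivative f (at x) v = frechet_derivative g (at x) v" if "x \<in> S" for x
      using frechet_derivative_at[OF d[OF that]] by simp
    show "k_smooth_on k S (\<lambda>x. frechet_derivative f (at x) v)" using Suc.prems(2) by simp
  qed
  then show ?case using d by (auto simp: differentiable_def)
qed

text \<open>Invariant vector fields arise by freezing one argument of (a derivative of) the group multiplication at
  the identity; this is how they inherit smoothness from the multiplication.\<close>

lemma k_smooth_on_slice: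
  fixes f :: "'a::real_normed_vector \<times> 'b::real_normed_vector \<Rightarrow> 'c::real_normed_vector"
  assumes "open D" "k_smooth_on k D f"
  shows "k_smooth_on k {q. (q, u) \<in> D} (\<lambda>q. f (q, u))"
  using assms(2)
proof (induction k arbitrary: f)
  case 0
  then have "continuous_on D f" by simp
  then have "continuous_on {q. (q, u) \<in> D} (f \<circ> (\<lambda>q. (q, u)))"
    by (intro continuous_on_compose continuous_intros) (auto elim: continuous_on_subset)
  then show ?case by (simp add: o_def)
next
  case (Suc k)
  let ?S = "{q. (q, u) \<in> D}"
  have "open ((\<lambda>q. (q, u)) -` D)"
    by (rule open_vimage[OF assms(1)]) (intro continuous_intros)
  then have op: "open ?S" by (simp add: vimage_def)
  have d: "((\<lambda>q. f (q, u)) has_derivative (\<lambda>v. frechet_derivative f (at (q, u)) (v, 0))) (at q)"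
    if "q \<in> ?S" for q
  proof -
    have "((\<lambda>q. (q, u)) has_derivative (\<lambda>v. (v, 0))) (at q)"
      by (intro derivative_intros)
    from diff_chain_at[OF this k_smooth_on_Suc_has_derivative[OF Suc.prems]] that
    show ?thesis by (simp add: o_def)
  qed
  have "k_smooth_on k ?S (\<lambda>q. frechet_derivative (\<lambda>q. f (q, u)) (at q) v)" for v
  proof (rule k_smooth_on_cong[OF op])
    show "k_smooth_on k ?S (\<lambda>q. frechet_derivative f (at (q, u)) (v, 0))"
      using Suc.IH[of "\<lambda>z. frechet_derivative f (at z) (v, 0)"] Suc.prems by simp
    show "frechet_derivative f (at (q, u)) (v, 0) = frechet_derivative (\<lambda>q. f (q, u)) (at q) v"
      if "q \<in> ?S" for q
      using frechet_derivative_at[OF d[OF that]] by metis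
  qed
  then show ?case using d by (auto simp: differentiable_def)
qed

section \<open>Connection and curvature of a bi-invariant metric\<close>

text \<open>The part of the structure of a Lie group that its local geometry depends on, seen in a chart domain
  \<open>U\<close>: \<open>q \<mapsto> L q a\<close> and \<open>q \<mapsto> N q a\<close> are the left-invariant and the right-invariant fields that
  extend the tangent vector \<open>a\<close> at the identity. The identity itself need not lie in \<open>U\<close>, so \<open>L q\<close> is not
  normalised to be the identity anywhere. Left and right translations commute, hence so do the two kinds of
  fields, and the left-invariant fields form a Lie algebra whose bracket \<open>K\<close> does not depend on \<open>q\<close>.\<close>

locale commuting_frames =
  fixes U :: "'e::real_inner set" and L N :: "'e \<Rightarrow> 'e \<Rightarrow> 'e" and K :: "'e \<Rightarrow> 'e \<Rightarrow> 'e"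
  assumes finite_dim: "\<exists>B::'e set. finite B \<and> span B = UNIV"
    and open_U: "open U"
    and linear_L: "q \<in> U \<Longrightarrow> linear (L q)"
    and linear_N: "q \<in> U \<Longrightarrow> linear (N q)"
    and smooth_L: "k_smooth_on 2 U (\<lambda>q. L q a)"
    and diff_N: "q \<in> U \<Longrightarrow> (\<lambda>q. N q a) differentiable (at q)"
    and commute: "q \<in> U \<Longrightarrow> frechet_derivative (\<lambda>q. L q a) (at q) (N q b)
                           = frechet_derivative (\<lambda>q. N q b) (at q) (L q a)"
    and bracket: "q \<in> U \<Longrightarrow> frechet_derivative (\<lambda>q. L q b) (at q) (L q a)
                          - frechet_derivative (\<lambda>q. L q a) (at q) (L q b) = L q (K a b)"
begin

abbreviation dL :: "'e \<Rightarrow> 'e \<Rightarrow> 'e \<Rightarrow> 'e" where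
  "dL a q \<equiv> frechet_derivative (\<lambda>q. L q a) (at q)"

abbreviation dN :: "'e \<Rightarrow> 'e \<Rightarrow> 'e \<Rightarrow> 'e" where
  "dN a q \<equiv> frechet_derivative (\<lambda>q. N q a) (at q)"

abbreviation ddL :: "'e \<Rightarrow> 'e \<Rightarrow> 'e \<Rightarrow> 'e \<Rightarrow> 'e" where
  "ddL a q v \<equiv> frechet_derivative (\<lambda>q. dL a q v) (at q)"

lemma has_derivative_L: "q \<in> U \<Longrightarrow> ((\<lambda>q. L q a) has_derivative dL a q) (at q)"
  using smooth_L[of a] by (simp add: numeral_2_eq_2 frechet_derivative_works[symmetric])

lemma has_derivative_dL: "q \<in> U \<Longrightarrow> ((\<lambda>q. dL a q v) has_derivative ddL a q v) (at q)"
  using smooth_L[of a] by (simp add: numeral_2_eq_2 frechet_derivative_works[symmetric])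

lemma has_derivative_N: "q \<in> U \<Longrightarrow> ((\<lambda>q. N q a) has_derivative dN a q) (at q)"
  using diff_N by (simp add: frechet_derivative_works[symmetric])

lemma ddL_symmetric: "q \<in> U \<Longrightarrow> ddL a q v w = ddL a q w v"
  using second_derivative_symmetric[OF smooth_L open_U] by simp

lemma linear_dL: "q \<in> U \<Longrightarrow> linear (dL a q)"
  using has_derivative_L has_derivative_linear by blast

lemma linear_dL_frame: "q \<in> U \<Longrightarrow> linear (\<lambda>a. dL a q v)"
  using linear_L has_derivative_L
  by (intro linear_frechet_derivative_family[OF _ open_U]) (auto simp: differentiable_def)

text \<open>The form \<open>\<eta>\<close> is the value of the tensor at the identity; it is the same for both frames because both
  equal the identity map there.\<close>

definition invariant_tensor :: "('e \<Rightarrow> 'e \<Rightarrow> 'e \<Rightarrow> real) \<Rightarrow> bool" where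
  "invariant_tensor t \<longleftrightarrow>
     (\<forall>q\<in>U. bilinear (t q)) \<and> (\<forall>q\<in>U. \<forall>a b. (\<lambda>q. t q a b) differentiable (at q)) \<and>
     (\<exists>\<eta>. \<forall>q\<in>U. \<forall>a b. t q (L q a) (L q b) = \<eta> a b \<and> t q (N q a) (N q b) = \<eta> a b)"

abbreviation dT :: "('e \<Rightarrow> 'e \<Rightarrow> 'e \<Rightarrow> real) \<Rightarrow> 'e \<Rightarrow> 'e \<Rightarrow> 'e \<Rightarrow> 'e \<Rightarrow> real" where
  "dT t q v a b \<equiv> frechet_derivative (\<lambda>q. t q a b) (at q) v"

lemma has_derivative_tensor_fields:
  assumes t: "invariant_tensor t" and q: "q \<in> U"
    and V: "(V has_derivative V') (at q)" and W: "(W has_derivative W') (at q)"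
  shows "((\<lambda>q. t q (V q) (W q)) has_derivative
    (\<lambda>v. dT t q v (V q) (W q) + t q (V' v) (W q) + t q (V q) (W' v))) (at q)"
proof -
  obtain B :: "'e set" where B: "finite B" "span B = UNIV" using finite_dim by blast
  have "((\<lambda>q. t q a b) has_derivative frechet_derivative (\<lambda>q. t q a b) (at q)) (at q)" for a b
    using t q by (simp add: invariant_tensor_def frechet_derivative_works[symmetric])
  moreover have "bilinear (t q)" if "q \<in> U" for q
    using t that by (simp add: invariant_tensor_def)
  ultimately show ?thesis
    using has_derivative_bilinear_family[OF B _ open_U q, of t "\<lambda>a b v. dT t q v a b", OF _ _ V W]
    by blast
qed

lemma constant_imp_derivative_zero:
  assumes "(f has_derivative f') (at q)" "q \<in> U" "\<And>q. q \<in> U \<Longrightarrow> f q = k"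
  shows "f' v = 0"
proof -
  have "(f has_derivative (\<lambda>v. 0)) (at q)"
    by (rule has_derivative_transform_within_open[OF has_derivative_const[of k] open_U assms(2)])
      (simp add: assms(3))
  then show ?thesis using assms(1) has_derivative_unique by metis
qed

text \<open>The two frames see a bi-invariant tensor with constant components; these are the product rules for
  the vanishing derivatives of those components.\<close>

lemma derivative_tensor_left_frame:
  assumes t: "invariant_tensor t" and q: "q \<in> U"
  shows "dT t q v (L q a) (L q b) + t q (dL a q v) (L q b) + t q (L q a) (dL b q v) = 0"
proof -
  obtain \<eta> where \<eta>: "\<And>q a b. q \<in> U \<Longrightarrow> t q (L q a) (L q b) = \<eta> a b"
    using t by (auto simp: invariant_tensor_def)
  show ?thesis
    by (rule constant_imp_derivative_zero[OF has_derivative_tensor_fields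
          [OF t q has_derivative_L[OF q] has_derivative_L[OF q]] q \<eta>])
qed

lemma derivative_tensor_right_frame:
  assumes t: "invariant_tensor t" and q: "q \<in> U"
  shows "dT t q v (N q a) (N q b) + t q (dN a q v) (N q b) + t q (N q a) (dN b q v) = 0"
proof -
  obtain \<eta> where \<eta>: "\<And>q a b. q \<in> U \<Longrightarrow> t q (N q a) (N q b) = \<eta> a b"
    using t by (auto simp: invariant_tensor_def)
  show ?thesis
    by (rule constant_imp_derivative_zero[OF has_derivative_tensor_fields
          [OF t q has_derivative_N[OF q] has_derivative_N[OF q]] q \<eta>])
qed

end

text \<open>Injectivity of the frames comes from positivity of the metric at the identity. That point may lie
  outside \<open>U\<close>, so injectivity is assumed separately from positivity on \<open>U\<close>.\<close>

locale biinvariant_metric = commuting_frames +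
  fixes h :: "'a \<Rightarrow> 'a \<Rightarrow> 'a \<Rightarrow> real"
  assumes invariant_h: "invariant_tensor h"
    and sym_h: "q \<in> U \<Longrightarrow> h q a b = h q b a"
    and pos_h: "q \<in> U \<Longrightarrow> a \<noteq> 0 \<Longrightarrow> h q a a > 0"
    and inj_L: "q \<in> U \<Longrightarrow> inj (L q)"
    and inj_N: "q \<in> U \<Longrightarrow> inj (N q)"
begin

lemma bilinear_h: "q \<in> U \<Longrightarrow> bilinear (h q)"
  using invariant_h by (simp add: invariant_tensor_def)

lemma h_nonneg: "q \<in> U \<Longrightarrow> h q a a \<ge> 0"
  using pos_h[of q a] bilinear_lzero[OF bilinear_h] by (cases "a = 0") auto

text \<open>In finite dimension, injectivity makes both frames bases of every tangent space, so that identities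
  between tensors may be checked on invariant fields.\<close>

lemma surj_L: "q \<in> U \<Longrightarrow> surj (L q)"
  using finite_dim linear_inj_imp_surj_finite_span[OF linear_L inj_L] by blast

lemma surj_N: "q \<in> U \<Longrightarrow> surj (N q)"
  using finite_dim linear_inj_imp_surj_finite_span[OF linear_N inj_N] by blast

lemma h_eqI:
  assumes q: "q \<in> U" and "\<And>c. h q a c = h q b c"
  shows "a = b"
proof (rule ccontr)
  assume "a \<noteq> b"
  then have "h q (a - b) (a - b) > 0" using pos_h[OF q] by simp
  then show False using assms(2)[of "a - b"] by (simp add: bilinear_lsub[OF bilinear_h[OF q]])
qed

text \<open>The Maurer-Cartan form: the components of a tangent vector in the left-invariant frame.\<close>

definition M :: "'a \<Rightarrow> 'a \<Rightarrow> 'a" where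
  "M q = inv_into UNIV (L q)"

lemma L_M [simp]: "q \<in> U \<Longrightarrow> L q (M q x) = x"
  using surj_L by (simp add: M_def surj_f_inv_f)

lemma M_L [simp]: "q \<in> U \<Longrightarrow> M q (L q a) = a"
  using inj_L by (simp add: M_def inv_f_f)

lemma linear_M:
  assumes q: "q \<in> U" shows "linear (M q)"
proof
  fix x y :: 'a and r :: real
  show "M q (x + y) = M q x + M q y"
    using M_L[OF q, of "M q x + M q y"] q by (simp add: linear_add[OF linear_L])
  show "M q (r *\<^sub>R x) = r *\<^sub>R M q x"
    using M_L[OF q, of "r *\<^sub>R M q x"] q by (simp add: linear_scale[OF linear_L])
qed

text \<open>The flow of a left-invariant field consists of right translations, so it preserves every bi-invariant
  tensor: its Lie derivative along \<open>q \<mapsto> L q a\<close> vanishes. Infinitesimally, the product rule in the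
  right-invariant frame turns into this identity once the derivatives of the right-invariant fields
  along \<open>L q a\<close> are exchanged, by commutation, for those of \<open>q \<mapsto> L q a\<close> along the right-invariant fields.\<close>

lemma tensor_killing:
  assumes t: "invariant_tensor t" and q: "q \<in> U"
  shows "dT t q (L q a) y z + t q (dL a q y) z + t q y (dL a q z) = 0"
proof -
  obtain b where "y = N q b" using surj_N[OF q] by (rule surjE)
  moreover obtain c where "z = N q c" using surj_N[OF q] by (rule surjE)
  ultimately show ?thesis
    using derivative_tensor_right_frame[OF t q, of b c "L q a"] commute[OF q] by simp
qed

text \<open>The formula \<open>\<nabla>\<^sub>X Y = [X, Y] / 2\<close> for left-invariant fields \<open>X\<close>, \<open>Y\<close>, rewritten for
  constant fields: subtracting \<open>\<partial>\<^sub>X Y\<close> from half of \<open>\<partial>\<^sub>X Y - \<partial>\<^sub>Y X\<close> leaves \<open>- (\<partial>\<^sub>X Y + \<partial>\<^sub>Y X) / 2\<close>. In this form the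
  torsion vanishes by inspection.\<close>

definition \<Gamma> :: "'a \<Rightarrow> 'a \<Rightarrow> 'a \<Rightarrow> 'a" where
  "\<Gamma> q b c = - (1 / 2) *\<^sub>R (dL (M q c) q b + dL (M q b) q c)"

lemma \<Gamma>_symmetric: "\<Gamma> q b c = \<Gamma> q c b"
  by (simp add: \<Gamma>_def add.commute)

lemma bilinear_\<Gamma>:
  assumes q: "q \<in> U" shows "bilinear (\<Gamma> q)"
proof -
  have "linear (\<lambda>c. \<Gamma> q b c)" for b
  proof -
    have "linear (\<lambda>c. dL (M q c) q b)"
      using linear_compose[OF linear_M[OF q] linear_dL_frame[OF q]] by (simp add: o_def)
    then show ?thesis unfolding \<Gamma>_def
      by (intro linear_compose_scale_right linear_compose_add linear_dL[OF q])
  qed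
  then show ?thesis using \<Gamma>_symmetric by (auto simp: bilinear_def)
qed

text \<open>Every bi-invariant tensor, the metric and the magnetic form alike, is parallel: its derivative is the
  average of the product rule in the left-invariant frame and of the Killing equation, and that average
  is exactly what \<open>\<Gamma>\<close> expresses.\<close>

lemma tensor_parallel:
  assumes t: "invariant_tensor t" and q: "q \<in> U"
  shows "dT t q a b c = t q (\<Gamma> q a b) c + t q b (\<Gamma> q a c)"
proof -
  have bil: "bilinear (t q)" using t q by (simp add: invariant_tensor_def)
  define a' b' c' where "a' = M q a" and "b' = M q b" and "c' = M q c"
  then have abc: "a = L q a'" "b = L q b'" "c = L q c'" using q by simp_all
  have "t q (\<Gamma> q a b) c = - (1 / 2) * (t q (dL b' q a) c + t q (dL a' q b) c)"
    "t q b (\<Gamma> q a c) = - (1 / 2) * (t q b (dL c' q a) + t q b (dL a' q c))"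
    unfolding \<Gamma>_def a'_def b'_def c'_def
    by (simp_all only: bilinear_ladd[OF bil] bilinear_radd[OF bil] bilinear_lmul[OF bil]
        bilinear_rmul[OF bil] real_scaleR_def)
  moreover have "dT t q a b c + t q (dL b' q a) c + t q b (dL c' q a) = 0"
    using derivative_tensor_left_frame[OF t q, of b' c' a] by (simp only: abc)
  moreover have "dT t q a b c + t q (dL a' q b) c + t q b (dL a' q c) = 0"
    using tensor_killing[OF t q, of b c a'] by (simp only: abc)
  \<comment> \<open>Averaging the product rule and the Killing equation.\<close>
  moreover have "d = g + g'" if "g = - (1 / 2) * (x + x')" "g' = - (1 / 2) * (y + y')"
    "d + x + y = 0" "d + x' + y' = 0" for d g g' x x' y y' :: real
  proof -
    have half: "2 * (- (1 / 2) * z) = - z" for z :: real by simp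
    have "2 * g = - (x + x')" "2 * g' = - (y + y')" unfolding that(1,2) by (rule half)+
    then show ?thesis using that(3,4) by linarith
  qed
  ultimately show ?thesis by blast
qed

text \<open>Uniqueness is the Koszul argument: the difference of two torsion-free metric connections is a trilinear
  form, symmetric in the first two and skew in the last two arguments; permuting the arguments six
  times shows that it equals its own negative.\<close>

lemma christoffel_eq_\<Gamma>:
  assumes q: "q \<in> U"
  shows "christoffel h q = \<Gamma> q"
  unfolding christoffel_def
proof (rule the_equality)
  show "bilinear (\<Gamma> q) \<and> (\<forall>a b. \<Gamma> q a b = \<Gamma> q b a) \<and>
    (\<forall>a b c. dT h q a b c = h q (\<Gamma> q a b) c + h q b (\<Gamma> q a c))"
    using bilinear_\<Gamma>[OF q] \<Gamma>_symmetric tensor_parallel[OF invariant_h q] by blast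
next
  fix G assume G: "bilinear G \<and> (\<forall>a b. G a b = G b a) \<and>
    (\<forall>a b c. dT h q a b c = h q (G a b) c + h q b (G a c))"
  \<comment> \<open>The difference tensor, with its output index lowered.\<close>
  define D where "D = (\<lambda>a b c. h q (G a b) c - h q (\<Gamma> q a b) c)"
  have D1: "D a b c = D b a c" for a b c
    using G \<Gamma>_symmetric by (metis D_def)
  have D2: "D a b c = - D a c b" for a b c
  proof -
    have "h q (G a b) c + h q b (G a c) = h q (\<Gamma> q a b) c + h q b (\<Gamma> q a c)"
      using G tensor_parallel[OF invariant_h q] by metis
    then show ?thesis
      unfolding D_def sym_h[OF q, of b] by simp
  qed
  have "D a b c = 0" for a b c
    using D1[of a b c] D2[of b a c] D1[of b c a] D2[of c b a] D1[of c a b] D2[of a c b] by linarith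
  then have "G a b = \<Gamma> q a b" for a b
    by (intro h_eqI[OF q]) (simp add: D_def)
  then show "G = \<Gamma> q" by blast
qed

text \<open>A basis of the Lie algebra that is orthonormal for the metric at the identity gives left-invariant fields
  that are orthonormal everywhere. Expanding vectors in them yields formulas for \<open>M\<close> and for the
  Lorentz operator from which differentiability can be read off, without differentiating an
  inverse matrix.\<close>

lemma orthonormal_frame:
  obtains C where "finite C" "\<And>q x. q \<in> U \<Longrightarrow> x = (\<Sum>e\<in>C. h q x (L q e) *\<^sub>R L q e)"
proof (cases "U = {}")
  case True
  then show ?thesis using that[of "{}"] by simp
next
  case False
  then obtain p where p: "p \<in> U" by blast
  obtain B :: "'a set" where B: "finite B" "span B = UNIV" using finite_dim by blast
  obtain \<eta> where \<eta>: "\<And>q a b. q \<in> U \<Longrightarrow> h q (L q a) (L q b) = \<eta> a b"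
    using invariant_h by (auto simp: invariant_tensor_def)
  have \<eta>p: "\<eta> = (\<lambda>a b. h p (L p a) (L p b))" using \<eta>[OF p] by (intro ext) simp
  have "bilinear \<eta>" unfolding \<eta>p bilinear_def
  proof (intro conjI allI)
    fix a
    have "linear (h p (L p a))" "linear (\<lambda>y. h p y (L p a))"
      using bilinear_h[OF p] by (simp_all add: bilinear_def)
    from this[THEN linear_compose[OF linear_L[OF p]]]
    show "linear (\<lambda>b. h p (L p a) (L p b))" "linear (\<lambda>b. h p (L p b) (L p a))"
      by (simp_all add: o_def)
  qed
  moreover have "\<eta> a a > 0" if "a \<noteq> 0" for a
    unfolding \<eta>p using that
    by (intro pos_h[OF p]) (metis M_L[OF p] linear_0[OF linear_M[OF p]])
  moreover have "\<eta> a b = \<eta> b a" for a b using \<eta>p sym_h[OF p] by simp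
  ultimately obtain C where C: "finite C" "span C = UNIV"
    and on: "\<And>c d. c \<in> C \<Longrightarrow> d \<in> C \<Longrightarrow> \<eta> c d = (if c = d then 1 else 0)"
    using orthonormal_spanning_set[OF B(1), of \<eta>] B(2) by metis
  show ?thesis
  proof (rule that[OF C(1)])
    fix q x assume q: "q \<in> U"
    obtain u where "M q x = (\<Sum>e\<in>C. u e *\<^sub>R e)"
      using C span_finite[OF C(1)] by (metis (no_types, lifting) UNIV_I image_iff)
    then have "x = L q (\<Sum>e\<in>C. u e *\<^sub>R e)" using L_M[OF q, of x] by simp
    also have "\<dots> = (\<Sum>e\<in>C. u e *\<^sub>R L q e)"
      by (simp add: linear_sum[OF linear_L[OF q]] linear_scale[OF linear_L[OF q]])
    finally have x: "x = (\<Sum>e\<in>C. u e *\<^sub>R L q e)" .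
    have "h q x (L q e) = u e" if "e \<in> C" for e
    proof -
      interpret l: linear "\<lambda>y. h q y (L q e)" using bilinear_h[OF q] by (simp add: bilinear_def)
      have "h q x (L q e) = (\<Sum>d\<in>C. u d * \<eta> d e)"
        using q by (subst x) (simp add: l.sum l.scale \<eta>)
      also have "\<dots> = (\<Sum>d\<in>C. if d = e then u e else 0)"
        by (intro sum.cong) (auto simp: on that)
      finally show ?thesis using that C(1) by simp
    qed
    then show "x = (\<Sum>e\<in>C. h q x (L q e) *\<^sub>R L q e)" using x by simp
  qed
qed

lemma differentiable_transform_U:
  assumes "q \<in> U" "\<And>q. q \<in> U \<Longrightarrow> f q = g q" "g differentiable (at q)"
  shows "f differentiable (at q)"
  using assms has_derivative_transform_within_open[OF _ open_U assms(1)]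
  unfolding differentiable_def by metis

lemma differentiable_tensor_fields:
  assumes "invariant_tensor t" "q \<in> U" "V differentiable (at q)" "W differentiable (at q)"
  shows "(\<lambda>q. t q (V q) (W q)) differentiable (at q)"
proof -
  obtain V' W' where "(V has_derivative V') (at q)" "(W has_derivative W') (at q)"
    using assms(3,4) unfolding differentiable_def by blast
  from has_derivative_tensor_fields[OF assms(1,2) this] show ?thesis
    unfolding differentiable_def by blast
qed

lemma differentiable_L: "q \<in> U \<Longrightarrow> (\<lambda>q. L q a) differentiable (at q)"
  using has_derivative_L unfolding differentiable_def by metis

lemma differentiable_M:
  assumes q: "q \<in> U" shows "(\<lambda>q. M q x) differentiable (at q)"
proof -
  obtain C where C: "finite C" "\<And>q x. q \<in> U \<Longrightarrow> x = (\<Sum>e\<in>C. h q x (L q e) *\<^sub>R L q e)"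
    using orthonormal_frame by blast
  have eq: "M q x = (\<Sum>e\<in>C. h q x (L q e) *\<^sub>R e)" if "q \<in> U" for q
  proof -
    interpret m: linear "M q" by (rule linear_M[OF that])
    have "M q x = M q (\<Sum>e\<in>C. h q x (L q e) *\<^sub>R L q e)" using C(2)[OF that, of x] by simp
    then show ?thesis using that by (simp add: m.sum m.scale)
  qed
  have "(\<lambda>q. \<Sum>e\<in>C. h q x (L q e) *\<^sub>R e) differentiable (at q)"
    by (intro differentiable_sum differentiable_scaleR C ballI differentiable_const
        differentiable_tensor_fields[OF invariant_h q] differentiable_L[OF q])
  then show ?thesis using differentiable_transform_U[OF q, of "\<lambda>q. M q x", OF eq] by blast
qed

lemma differentiable_\<Gamma>:
  assumes q: "q \<in> U" shows "(\<lambda>q. \<Gamma> q b c) differentiable (at q)"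
proof -
  obtain B :: "'a set" where B: "finite B" "span B = UNIV" using finite_dim by blast
  have "(\<lambda>q. dL (M q c) q b) differentiable (at q)" for b c
  proof -
    obtain M' where "((\<lambda>q. M q c) has_derivative M') (at q)"
      using differentiable_M[OF q] unfolding differentiable_def by blast
    then show ?thesis
      using has_derivative_linear_family[where F = "\<lambda>q a. dL a q b", OF B linear_dL_frame open_U q
          has_derivative_dL[OF q], of "\<lambda>q. M q c" M']
      unfolding differentiable_def by blast
  qed
  then show ?thesis unfolding \<Gamma>_def
    by (intro differentiable_scaleR differentiable_add differentiable_const) auto
qed

lemma cov_constant_fields: "q \<in> U \<Longrightarrow> cov h (\<lambda>_. a) (\<lambda>_. b) q = \<Gamma> q a b"
  by (simp add: cov_def christoffel_eq_\<Gamma>)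

text \<open>The derivative in the curvature sees the Christoffel symbols in a whole neighbourhood, which is why they
  must be identified on all of \<open>U\<close> and not just at one point.\<close>

lemma curvature_eq_\<Gamma>:
  assumes q: "q \<in> U"
  shows "curvature h q a b c =
    (frechet_derivative (\<lambda>q. \<Gamma> q b c) (at q) a + \<Gamma> q a (\<Gamma> q b c)) -
    (frechet_derivative (\<lambda>q. \<Gamma> q a c) (at q) b + \<Gamma> q b (\<Gamma> q a c))"
proof -
  have "frechet_derivative (cov h (\<lambda>_. b) (\<lambda>_. c)) (at q) = frechet_derivative (\<lambda>q. \<Gamma> q b c) (at q)" for b c
    by (rule frechet_derivative_transform_within_open[symmetric, OF differentiable_\<Gamma>[OF q] open_U q])
      (simp add: cov_constant_fields)
  then show ?thesis
    by (simp add: curvature_def cov_def[of h "\<lambda>_. a" "cov h _ _"] cov_def[of h "\<lambda>_. b" "cov h _ _"]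
        cov_constant_fields[OF q] christoffel_eq_\<Gamma>[OF q])
qed

lemma \<Gamma>_left_fields:
  assumes q: "q \<in> U" shows "\<Gamma> q (L q b) (L q c) = (1 / 2) *\<^sub>R L q (K b c) - dL c q (L q b)"
proof -
  have "dL b q (L q c) = dL c q (L q b) - L q (K b c)"
    using bracket[OF q, of c b] by (simp add: algebra_simps)
  moreover have "- (1 / 2) *\<^sub>R (x + (x - y)) = (1 / 2) *\<^sub>R y - x" for x y :: 'a
  proof -
    have "x + (x - y) = 2 *\<^sub>R x - y" by (simp add: scaleR_2)
    then show ?thesis by (simp only: scaleR_diff_right scaleR_scaleR) simp
  qed
  ultimately show ?thesis by (simp add: \<Gamma>_def q)
qed

text \<open>Both sides of the identity \<open>\<Gamma> q (L q b) (L q c) = L q (K b c) / 2 - dL c q (L q b)\<close> are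
  differentiated, and the result is solved for the derivative of \<open>\<Gamma>\<close> at fixed arguments.\<close>

lemma derivative_\<Gamma>_left_fields:
  assumes q: "q \<in> U"
  shows "frechet_derivative (\<lambda>r. \<Gamma> r (L q b) (L q c)) (at q) v =
    (1 / 2) *\<^sub>R dL (K b c) q v - ddL c q (L q b) v - dL c q (dL b q v)
    - \<Gamma> q (dL b q v) (L q c) - \<Gamma> q (L q b) (dL c q v)"
proof -
  obtain B :: "'a set" where B: "finite B" "span B = UNIV" using finite_dim by blast
  have d: "((\<lambda>q. \<Gamma> q a b) has_derivative frechet_derivative (\<lambda>q. \<Gamma> q a b) (at q)) (at q)" for a b
    using differentiable_\<Gamma>[OF q] by (simp add: frechet_derivative_works[symmetric])
  have "((\<lambda>q. \<Gamma> q (L q b) (L q c)) has_derivative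
      (\<lambda>v. frechet_derivative (\<lambda>r. \<Gamma> r (L q b) (L q c)) (at q) v +
           \<Gamma> q (dL b q v) (L q c) + \<Gamma> q (L q b) (dL c q v))) (at q)"
    by (rule has_derivative_bilinear_family[OF B bilinear_\<Gamma> open_U q d
          has_derivative_L[OF q] has_derivative_L[OF q]])
  moreover have "((\<lambda>q. \<Gamma> q (L q b) (L q c)) has_derivative
      (\<lambda>v. (1 / 2) *\<^sub>R dL (K b c) q v - (ddL c q (L q b) v + dL c q (dL b q v)))) (at q)"
  proof (rule has_derivative_transform_within_open[OF _ open_U q])
    show "((\<lambda>q. (1 / 2) *\<^sub>R L q (K b c) - dL c q (L q b)) has_derivative
      (\<lambda>v. (1 / 2) *\<^sub>R dL (K b c) q v - (ddL c q (L q b) v + dL c q (dL b q v)))) (at q)"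
      by (intro has_derivative_diff has_derivative_scaleR_right has_derivative_L q
          has_derivative_linear_family[OF B linear_dL open_U q has_derivative_dL])
  qed (simp add: \<Gamma>_left_fields)
  ultimately have "(\<lambda>v. frechet_derivative (\<lambda>r. \<Gamma> r (L q b) (L q c)) (at q) v +
           \<Gamma> q (dL b q v) (L q c) + \<Gamma> q (L q b) (dL c q v)) =
      (\<lambda>v. (1 / 2) *\<^sub>R dL (K b c) q v - (ddL c q (L q b) v + dL c q (dL b q v)))"
    by (rule has_derivative_unique)
  from fun_cong[OF this, of v] show ?thesis by (simp add: algebra_simps)
qed

text \<open>This is \<open>R(X, Y) Z = \<nabla>\<^sub>X \<nabla>\<^sub>Y Z - \<nabla>\<^sub>Y \<nabla>\<^sub>X Z - \<nabla>\<^bsub>[X, Y]\<^esub> Z\<close> with every \<open>\<nabla>\<close> replaced by half a bracket.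
  After antisymmetrising in \<open>a\<close> and \<open>b\<close>, the second derivatives of the fields cancel by Schwarz's theorem
  and the mixed terms cancel because they are symmetric.\<close>

theorem curvature_left_fields:
  assumes q: "q \<in> U"
  shows "curvature h q (L q a) (L q b) (L q c) =
    (1 / 4) *\<^sub>R L q (K a (K b c)) - (1 / 4) *\<^sub>R L q (K b (K a c)) - (1 / 2) *\<^sub>R L q (K (K a b) c)"
proof -
  note bil = bilinear_\<Gamma>[OF q]
  note br = bracket[OF q]
  define S where "S = (\<lambda>a b. frechet_derivative (\<lambda>r. \<Gamma> r (L q b) (L q c)) (at q) (L q a)
    + \<Gamma> q (L q a) (\<Gamma> q (L q b) (L q c)))"
  have S: "S a b = (1 / 4) *\<^sub>R L q (K a (K b c)) - ddL c q (L q b) (L q a)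
    - (dL c q (dL b q (L q a)) + \<Gamma> q (dL b q (L q a)) (L q c))
    - (\<Gamma> q (L q b) (dL c q (L q a)) + \<Gamma> q (L q a) (dL c q (L q b)))" for a b
  proof -
    have d: "dL (K b c) q (L q a) = (1 / 2) *\<^sub>R L q (K a (K b c)) - \<Gamma> q (L q a) (L q (K b c))"
      by (simp add: \<Gamma>_left_fields[OF q])
    show ?thesis
      unfolding S_def derivative_\<Gamma>_left_fields[OF q] \<Gamma>_left_fields[OF q, of b c] d
      by (simp add: bilinear_rsub[OF bil] bilinear_rmul[OF bil] algebra_simps)
  qed
  \<comment> \<open>Together these terms are \<open>\<nabla>\<^bsub>[X, Y]\<^esub> Z\<close>.\<close>
  have z: "dL c q (dL b q (L q a)) + \<Gamma> q (dL b q (L q a)) (L q c)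
      - (dL c q (dL a q (L q b)) + \<Gamma> q (dL a q (L q b)) (L q c)) = (1 / 2) *\<^sub>R L q (K (K a b) c)"
  proof -
    have "dL c q (L q (K a b)) = dL c q (dL b q (L q a)) - dL c q (dL a q (L q b))"
      by (simp add: linear_diff[OF linear_dL[OF q]] flip: br)
    moreover have "\<Gamma> q (L q (K a b)) (L q c)
        = \<Gamma> q (dL b q (L q a)) (L q c) - \<Gamma> q (dL a q (L q b)) (L q c)"
      by (simp add: bilinear_lsub[OF bil] flip: br)
    moreover have "dL c q (L q (K a b)) + \<Gamma> q (L q (K a b)) (L q c) = (1 / 2) *\<^sub>R L q (K (K a b) c)"
      by (simp add: \<Gamma>_left_fields[OF q])
    ultimately show ?thesis by (metis add_diff_add)
  qed
  have "curvature h q (L q a) (L q b) (L q c) = S a b - S b a"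
    by (simp add: curvature_eq_\<Gamma>[OF q] S_def)
  also have "\<dots> = (1 / 4) *\<^sub>R L q (K a (K b c)) - (1 / 4) *\<^sub>R L q (K b (K a c)) - (1 / 2) *\<^sub>R L q (K (K a b) c)"
    unfolding z[symmetric] S ddL_symmetric[OF q, of c "L q b" "L q a"] by (simp add: algebra_simps)
  finally show ?thesis .
qed

text \<open>Infinitesimal invariance under the adjoint action: the difference of the two descriptions of the
  derivative of the tensor along a left-invariant field.\<close>

lemma tensor_ad_invariant:
  assumes t: "invariant_tensor t" and q: "q \<in> U"
  shows "t q (L q (K a b)) (L q c) + t q (L q b) (L q (K a c)) = 0"
proof -
  have bil: "bilinear (t q)" using t q by (simp add: invariant_tensor_def)
  show ?thesis
    using derivative_tensor_left_frame[OF t q, of b c "L q a"] tensor_killing[OF t q, of "L q b" "L q c" a]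
    by (simp add: bilinear_lsub[OF bil] bilinear_rsub[OF bil] flip: bracket[OF q])
qed

lemma K_skew: "q \<in> U \<Longrightarrow> K a b = - K b a"
proof -
  assume q: "q \<in> U"
  have "L q (K a b) = L q (- K b a)"
    by (simp add: linear_neg[OF linear_L[OF q]] flip: bracket[OF q])
  then show ?thesis using inj_L[OF q] by (simp add: inj_eq)
qed

lemma K_refl: "q \<in> U \<Longrightarrow> K a a = 0"
  using bracket[of q a a] M_L[of q "K a a"] linear_0[OF linear_M[of q]] by simp

lemma linear_K: "U \<noteq> {} \<Longrightarrow> linear (K a)"
proof -
  assume "U \<noteq> {}"
  then obtain q where q: "q \<in> U" by blast
  have "K a = (\<lambda>b. M q (dL b q (L q a) - dL a q (L q b)))"
    by (simp add: bracket[OF q] q)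
  moreover have "linear (\<lambda>b. M q (dL b q (L q a) - dL a q (L q b)))"
    using linear_compose[OF linear_compose_sub[OF linear_dL_frame[OF q, of "L q a"]
          linear_compose[OF linear_L[OF q] linear_dL[OF q, of a]]] linear_M[OF q]]
    by (simp add: o_def)
  ultimately show ?thesis by simp
qed

text \<open>Skewness of \<open>K\<close> reduces the curvature to \<open>- K a (K a b) / 4\<close>, and one bracket moves to the other side of the
  metric by ad-invariance.\<close>

theorem sectional_curvature:
  assumes q: "q \<in> U"
  shows "h q (curvature h q w v v) w
    = (1 / 4) * h q (L q (K (M q v) (M q w))) (L q (K (M q v) (M q w)))"
proof -
  define a b where "a = M q v" and "b = M q w"
  have ab: "v = L q a" "w = L q b" using q by (simp_all add: a_def b_def)
  note bil = bilinear_h[OF q]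
  have lin: "linear (K x)" for x using linear_K q by blast
  have 1: "h q (L q (K a (K a b))) w = - h q (L q (K a b)) (L q (K a b))"
    using tensor_ad_invariant[OF invariant_h q, of a "K a b" b] ab(2) by simp
  have "curvature h q w v v = (1 / 4) *\<^sub>R L q (K b (K a a)) - (1 / 4) *\<^sub>R L q (K a (K b a))
      - (1 / 2) *\<^sub>R L q (K (K b a) a)"
    unfolding ab by (rule curvature_left_fields[OF q])
  also have "K (K b a) a = K a (K a b)"
    using K_skew[OF q, of "K b a" a] K_skew[OF q, of b a] linear_neg[OF lin] by simp
  also have "K a (K b a) = - K a (K a b)"
    using K_skew[OF q, of b a] linear_neg[OF lin] by simp
  also have "(1 / 4) *\<^sub>R L q (K b (K a a)) - (1 / 4) *\<^sub>R L q (- K a (K a b))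
      - (1 / 2) *\<^sub>R L q (K a (K a b)) = (1 / 4 - 1 / 2) *\<^sub>R L q (K a (K a b))"
    using K_refl[OF q, of a] linear_0[OF lin] linear_0[OF linear_L[OF q]] linear_neg[OF linear_L[OF q]]
    unfolding scaleR_left_diff_distrib by simp
  finally have "curvature h q w v v = - (1 / 4) *\<^sub>R L q (K a (K a b))" by simp
  then show ?thesis
    using 1 by (simp add: bilinear_lmul[OF bil] bilinear_lneg[OF bil] flip: a_def b_def)
qed

text \<open>The orthonormal frame \<open>e\<close> raises the index: \<open>Y a = \<Sum>e. \<tau>(a, e) e\<close>.\<close>

lemma lorentz_properties:
  assumes t: "invariant_tensor \<tau>" and q: "q \<in> U"
  shows lorentz_linear: "linear (lorentz h \<tau> q)"
    and lorentz_eq: "h q (lorentz h \<tau> q a) b = \<tau> q a b"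
    and lorentz_differentiable: "(\<lambda>q. lorentz h \<tau> q a) differentiable (at q)"
proof -
  obtain C where C: "finite C" "\<And>q x. q \<in> U \<Longrightarrow> x = (\<Sum>e\<in>C. h q x (L q e) *\<^sub>R L q e)"
    using orthonormal_frame by blast
  define Y where "Y = (\<lambda>q a. \<Sum>e\<in>C. \<tau> q a (L q e) *\<^sub>R L q e)"
  have Y: "linear (Y q)" "h q (Y q a) b = \<tau> q a b" if q: "q \<in> U" for q a b
  proof -
    have bil: "bilinear (\<tau> q)" using t q by (simp add: invariant_tensor_def)
    show "linear (Y q)" unfolding Y_def
      by (intro linearI)
        (simp_all add: bilinear_ladd[OF bil] bilinear_lmul[OF bil] scaleR_left_distrib
          sum.distrib scaleR_right.sum)
    interpret l: linear "\<lambda>y. h q y b" using bilinear_h[OF q] by (simp add: bilinear_def)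
    interpret r: linear "\<tau> q a" using bil by (simp add: bilinear_def)
    have "h q (Y q a) b = (\<Sum>e\<in>C. \<tau> q a (L q e) * h q b (L q e))"
      unfolding Y_def by (simp add: l.sum l.scale sym_h[OF q, of b])
    also have "\<dots> = \<tau> q a (\<Sum>e\<in>C. h q b (L q e) *\<^sub>R L q e)"
      by (simp add: r.sum r.scale mult.commute)
    also have "\<dots> = \<tau> q a b" using C(2)[OF q, of b] by simp
    finally show "h q (Y q a) b = \<tau> q a b" .
  qed
  have eq: "lorentz h \<tau> q = Y q" if q: "q \<in> U" for q
    unfolding lorentz_def
  proof (rule the_equality)
    show "linear (Y q) \<and> (\<forall>a b. \<tau> q a b = h q (Y q a) b)" using Y[OF q] by simp
    show "Z = Y q" if "linear Z \<and> (\<forall>a b. \<tau> q a b = h q (Z a) b)" for Z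
      using that Y(2)[OF q] by (intro ext h_eqI[OF q]) metis
  qed
  show "linear (lorentz h \<tau> q)" "h q (lorentz h \<tau> q a) b = \<tau> q a b"
    using Y[OF q] by (simp_all add: eq[OF q])
  have "(\<lambda>q. Y q a) differentiable (at q)"
    unfolding Y_def
    by (intro differentiable_sum differentiable_scaleR C ballI differentiable_const
        differentiable_tensor_fields[OF t q] differentiable_L[OF q])
  then show "(\<lambda>q. lorentz h \<tau> q a) differentiable (at q)"
    by (rule differentiable_transform_U[OF q, rotated]) (simp add: eq)
qed

text \<open>The operator is built from the metric and the 2-form, both of which are parallel.\<close>

lemma lorentz_parallel:
  assumes t: "invariant_tensor \<tau>" and q: "q \<in> U"
  shows "cov_lorentz h \<tau> q a b = 0"
proof (rule h_eqI[OF q])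
  fix c
  note bil = bilinear_h[OF q]
  let ?Y = "\<lambda>q. lorentz h \<tau> q b"
  let ?DY = "frechet_derivative ?Y (at q)"
  have DY: "(?Y has_derivative ?DY) (at q)"
    using lorentz_differentiable[OF t q] by (simp add: frechet_derivative_works[symmetric])
  have "((\<lambda>q. \<tau> q b c) has_derivative
      (\<lambda>v. dT h q v (?Y q) c + h q (?DY v) c + h q (?Y q) 0)) (at q)"
    by (rule has_derivative_transform_within_open[OF has_derivative_tensor_fields
          [OF invariant_h q DY has_derivative_const[of c]] open_U q])
      (simp add: lorentz_eq[OF t])
  then have "dT \<tau> q a b c = dT h q a (?Y q) c + h q (?DY a) c"
    by (simp add: frechet_derivative_at[symmetric] bilinear_rzero[OF bil])
  moreover have "dT h q a (?Y q) c = h q (\<Gamma> q a (?Y q)) c + h q (?Y q) (\<Gamma> q a c)"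
    by (rule tensor_parallel[OF invariant_h q])
  moreover have "dT \<tau> q a b c = \<tau> q (\<Gamma> q a b) c + \<tau> q b (\<Gamma> q a c)"
    by (rule tensor_parallel[OF t q])
  ultimately show "h q (cov_lorentz h \<tau> q a b) c = h q 0 c"
    unfolding cov_lorentz_def cov_constant_fields[OF q] cov_def[of h _ ?Y] christoffel_eq_\<Gamma>[OF q]
    by (simp add: bilinear_lsub[OF bil] bilinear_ladd[OF bil] bilinear_lzero[OF bil] lorentz_eq[OF t q])
qed

text \<open>The bracket at \<open>q\<close> of the left-invariant fields through \<open>v\<close> and \<open>w\<close>.\<close>

definition lie_bracket_at :: "'a \<Rightarrow> 'a \<Rightarrow> 'a \<Rightarrow> 'a" where
  "lie_bracket_at q v w = L q (K (M q v) (M q w))"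

text \<open>The terms with \<open>\<nabla>Y\<close> vanish, so the term linear in \<open>s\<close> is gone. The remaining terms are squares: skewness of \<open>Y\<close>
  turns \<open>g(Y(g(v, Y w) v), w)\<close> into \<open>- \<tau>(v, w)\<^sup>2\<close> and \<open>g(Y(Y w), w)\<close> into \<open>- g(Y w, Y w)\<close>; the projection
  onto the complement of \<open>v\<close> does not change the product with \<open>w\<close>.\<close>

theorem magnetic_sectional_curvature:
  assumes t: "invariant_tensor \<tau>" and alt: "\<And>a. \<tau> q a a = 0" and q: "q \<in> U"
    and on: "h q v v = 1" "h q w w = 1" "h q v w = 0"
  shows "h q (magnetic_R h \<tau> s q v w + magnetic_A h \<tau> q v w) w =
    s\<^sup>2 / 4 * h q (lie_bracket_at q v w) (lie_bracket_at q v w)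
    + 3 / 4 * (\<tau> q v w)\<^sup>2 + 1 / 4 * h q (lorentz h \<tau> q w) (lorentz h \<tau> q w)"
proof -
  note bil = bilinear_h[OF q]
  note h_simps = bilinear_ladd[OF bil] bilinear_lmul[OF bil] bilinear_lsub[OF bil]
    bilinear_lzero[OF bil] bilinear_lneg[OF bil]
  have bt: "bilinear (\<tau> q)" using t q by (simp add: invariant_tensor_def)
  have skew: "\<tau> q a b = - \<tau> q b a" for a b
    using alt[of "a + b"] alt[of a] alt[of b]
    by (simp add: bilinear_ladd[OF bt] bilinear_radd[OF bt])
  let ?Y = "lorentz h \<tau> q"
  have R: "h q (magnetic_R h \<tau> s q v w) w
      = s\<^sup>2 / 4 * h q (lie_bracket_at q v w) (lie_bracket_at q v w)"
    unfolding magnetic_R_def lorentz_parallel[OF t q] proj_perp_def proj_along_def lie_bracket_at_def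
    using bilinear_rzero[OF bil] by (simp add: h_simps sectional_curvature[OF q])
  have vY: "h q v (?Y w) = - \<tau> q v w" "h q (?Y w) v = - \<tau> q v w" "h q (?Y v) w = \<tau> q v w"
    using sym_h[OF q, of v] lorentz_eq[OF t q] skew[of v w] by simp_all
  have YY: "h q (?Y (?Y w)) w = - h q (?Y w) (?Y w)"
    using lorentz_eq[OF t q] skew[of w "?Y w"] by simp
  have A: "h q (magnetic_A h \<tau> q v w) w = 3 / 4 * (\<tau> q v w)\<^sup>2 + 1 / 4 * h q (?Y w) (?Y w)"
    unfolding magnetic_A_def Let_def proj_perp_def proj_along_def
    by (simp add: h_simps linear_scale[OF lorentz_linear[OF t q]] linear_neg[OF lorentz_linear[OF t q]]
        vY YY on power2_eq_square)
  show ?thesis by (simp add: bilinear_ladd[OF bil] R A)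
qed

lemma lie_bracket_at_bilinear: "q \<in> U \<Longrightarrow> bilinear (lie_bracket_at q)"
proof -
  assume q: "q \<in> U"
  have l: "linear (lie_bracket_at q v)" for v
    unfolding lie_bracket_at_def
    using linear_compose[OF linear_compose[OF linear_M[OF q] linear_K] linear_L[OF q]] q
    by (auto simp: o_def)
  have "lie_bracket_at q v w = - lie_bracket_at q w v" for v w
    unfolding lie_bracket_at_def
    using K_skew[OF q, of "M q v" "M q w"] linear_neg[OF linear_L[OF q]] by simp
  then have "(\<lambda>v. lie_bracket_at q v w) = (\<lambda>v. - lie_bracket_at q w v)" for w by blast
  then show ?thesis using l by (simp add: bilinear_def linear_compose_neg)
qed

lemma lie_bracket_at_refl: "q \<in> U \<Longrightarrow> lie_bracket_at q v v = 0"
  by (simp add: lie_bracket_at_def K_refl linear_0[OF linear_L])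

text \<open>Gram-Schmidt in a plane. If there are no orthonormal pairs at all, as in dimension at most 1, the
  statement says that alternating forms vanish there; the proof covers this case because then
  \<open>v\<close> or the component of \<open>w\<close> orthogonal to \<open>v\<close> is zero.\<close>

lemma alternating_zero_if_zero_on_orthonormal:
  fixes \<beta> :: "'a \<Rightarrow> 'a \<Rightarrow> 'b::real_vector"
  assumes q: "q \<in> U" and bil: "bilinear \<beta>" and alt: "\<And>v. \<beta> v v = 0"
    and on: "\<And>v w. h q v v = 1 \<Longrightarrow> h q w w = 1 \<Longrightarrow> h q v w = 0 \<Longrightarrow> \<beta> v w = 0"
  shows "\<beta> v w = 0"
proof (cases "v = 0")
  case True
  then show ?thesis using bilinear_lzero[OF bil] by simp
next
  case False
  note bh = bilinear_h[OF q]
  define n where "n = (\<lambda>x. (1 / sqrt (h q x x)) *\<^sub>R x)"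
  have n: "h q (n x) (n x) = 1" "x = sqrt (h q x x) *\<^sub>R n x" if "x \<noteq> 0" for x
    using pos_h[OF q that] that by (simp_all add: n_def bilinear_lmul[OF bh] bilinear_rmul[OF bh])
  define u where "u = w - h q (n v) w *\<^sub>R n v"
  have u: "h q (n v) u = 0"
    using n(1)[OF False] by (simp add: u_def bilinear_rsub[OF bh] bilinear_rmul[OF bh])
  have "\<beta> (n v) u = 0"
  proof (cases "u = 0")
    case True
    then show ?thesis using bilinear_rzero[OF bil] by simp
  next
    case nz: False
    have "h q (n v) (n u) = 0" using u by (auto simp add: n_def bilinear_rmul[OF bh] bilinear_lmul[OF bh])
    then have "\<beta> (n v) (n u) = 0" using on n(1) False nz by blast
    then show ?thesis using n(2)[OF nz] bilinear_rmul[OF bil] by (metis scaleR_zero_right)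
  qed
  then have "\<beta> (n v) w = 0"
    by (simp add: u_def bilinear_rsub[OF bil] bilinear_rmul[OF bil] alt)
  then show ?thesis using n(2)[OF False] bilinear_lmul[OF bil] by (metis scaleR_zero_right)
qed

text \<open>The function whose derivative is computed is \<open>g(a, Ad b)\<close>, up to identification of the tangent spaces;
  if the Lie algebra is abelian, the adjoint action is locally constant.\<close>

lemma derivative_left_right_pairing:
  assumes q: "q \<in> U" and K0: "\<And>a b. K a b = 0"
  shows "((\<lambda>q. h q (L q a) (N q b)) has_derivative (\<lambda>v. 0)) (at q)"
proof -
  have "dT h q v (L q a) (N q b) + h q (dL a q v) (N q b) + h q (L q a) (dN b q v) = 0" for v
  proof -
    have v: "v = L q (M q v)" using q by simp
    have "dL a q (L q (M q v)) = dL (M q v) q (L q a)"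
      using bracket[OF q, of a "M q v"] K0 linear_0[OF linear_L[OF q]] by simp
    then show ?thesis
      using tensor_killing[OF invariant_h q, of "L q a" "N q b" "M q v"] commute[OF q, of "M q v" b] v by simp
  qed
  then show ?thesis
    using has_derivative_tensor_fields[OF invariant_h q has_derivative_L[OF q, of a]
        has_derivative_N[OF q, of b]]
    by simp
qed

text \<open>If the frames coincide, the commutation of left with right fields is commutation among left fields.\<close>

lemma left_right_agree_imp_K_zero:
  assumes q: "q \<in> U" and LN: "\<And>q a. q \<in> U \<Longrightarrow> L q a = N q a"
  shows "K a b = 0"
proof -
  have "dL b q v = dN b q v" for v
    using frechet_derivative_transform_within_open[OF differentiable_L[OF q] open_U q, of b] LN by metis
  then have "L q (K a b) = 0"
    using bracket[OF q, of b a] commute[OF q, of a b] LN[OF q] by simp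
  then show ?thesis using M_L[OF q, of "K a b"] linear_0[OF linear_M[OF q]] by simp
qed

end

section \<open>Group multiplication and invariant fields in charts\<close>

locale lie_group_with_charts = group G for G (structure) +
  fixes T :: "'a topology" and A :: "('a, 'e::real_inner) chart set"
  assumes lie: "lie_group G T A"
begin

lemma finite_dim: "\<exists>B::'e set. finite B \<and> span B = UNIV"
  using lie by (simp add: lie_group_def smooth_manifold_def)

lemma topspace_eq: "topspace T = carrier G"
  using lie by (simp add: lie_group_def)

lemma carrier_eq_points: "carrier G = points A"
  using lie by (simp add: lie_group_def smooth_manifold_def)

lemma chart_exists: "x \<in> carrier G \<Longrightarrow> \<exists>c\<in>A. x \<in> dom_of c"
  by (auto simp: carrier_eq_points points_def)

lemma chart_at: "x \<in> carrier G \<Longrightarrow> chart_at A x \<in> A \<and> x \<in> dom_of (chart_at A x)"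
  unfolding chart_at_def by (rule someI_ex) (use chart_exists in blast)

lemma dom_carrier: "c \<in> A \<Longrightarrow> x \<in> dom_of c \<Longrightarrow> x \<in> carrier G"
  by (auto simp: carrier_eq_points points_def)

lemma open_dom: "c \<in> A \<Longrightarrow> openin T (dom_of c)"
  and open_img: "c \<in> A \<Longrightarrow> open (img_of c)"
  and homeo_chart: "c \<in> A \<Longrightarrow>
    homeomorphic_map (subtopology T (dom_of c)) (top_of_set (img_of c)) (crd c)"
  using lie by (auto simp: lie_group_def smooth_manifold_def)

lemma inj_chart: "c \<in> A \<Longrightarrow> inj_on (crd c) (dom_of c)"
  using homeomorphic_imp_injective_map[OF homeo_chart] dom_carrier
  by (metis open_dom openin_subset topspace_subtopology_subset)

lemma chart_inv_crd [simp]: "c \<in> A \<Longrightarrow> x \<in> dom_of c \<Longrightarrow> chart_inv c (crd c x) = x"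
  by (simp add: chart_inv_def the_inv_into_f_f inj_chart)

lemma crd_chart_inv [simp]: "c \<in> A \<Longrightarrow> q \<in> img_of c \<Longrightarrow> crd c (chart_inv c q) = q"
  by (auto simp: img_of_def)

lemma chart_inv_dom [simp]: "c \<in> A \<Longrightarrow> q \<in> img_of c \<Longrightarrow> chart_inv c q \<in> dom_of c"
  by (auto simp: img_of_def)

lemma chart_inv_carrier [simp]: "c \<in> A \<Longrightarrow> q \<in> img_of c \<Longrightarrow> chart_inv c q \<in> carrier G"
  using chart_inv_dom dom_carrier by blast

lemma crd_img [simp]: "x \<in> dom_of c \<Longrightarrow> crd c x \<in> img_of c"
  by (simp add: img_of_def)

lemma continuous_chart_inv:
  assumes c: "c \<in> A" shows "continuous_map (top_of_set (img_of c)) T (chart_inv c)"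
proof -
  obtain k where k: "homeomorphic_maps (subtopology T (dom_of c)) (top_of_set (img_of c)) (crd c) k"
    using homeo_chart[OF c] by (auto simp: homeomorphic_map_maps)
  then have "continuous_map (top_of_set (img_of c)) T k"
    by (auto simp: homeomorphic_maps_def continuous_map_in_subtopology)
  moreover have "k q = chart_inv c q" if "q \<in> topspace (top_of_set (img_of c))" for q
  proof -
    have "k q \<in> dom_of c" "crd c (k q) = q"
      using k that by (auto simp: homeomorphic_maps_def continuous_map_in_subtopology)
    then show ?thesis using chart_inv_crd[OF c] by metis
  qed
  ultimately show ?thesis by (rule continuous_map_eq)
qed

lemma open_preimage:
  assumes "c \<in> A" "openin T S" shows "open {q \<in> img_of c. chart_inv c q \<in> S}"
  using openin_continuous_map_preimage[OF continuous_chart_inv[OF assms(1)] assms(2)]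
    openin_open_trans[OF _ open_img[OF assms(1)]] by simp

lemma open_image:
  assumes c: "c \<in> A" and "open V" shows "openin T {x \<in> dom_of c. crd c x \<in> V}"
proof -
  have "continuous_map (subtopology T (dom_of c)) euclidean (crd c)"
    using homeo_chart[OF c] homeomorphic_imp_continuous_map continuous_map_in_subtopology by blast
  from openin_continuous_map_preimage[OF this, of V]
  have "openin (subtopology T (dom_of c)) {x \<in> dom_of c. crd c x \<in> V}"
    using assms(2) openin_subset[OF open_dom[OF c]] by (simp add: Int_absorb1)
  then show ?thesis using open_dom[OF c] openin_trans_full by blast
qed

text \<open>The sets where \<open>f\<close> takes, respectively avoids, the value \<open>f x\<close> are both open.\<close>

lemma locally_constant_imp_constant:
  assumes conn: "connected_space T"
    and loc: "\<And>c q. c \<in> A \<Longrightarrow> q \<in> img_of c \<Longrightarrow>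
      \<exists>r>0. \<forall>q'\<in>ball q r \<inter> img_of c. f (chart_inv c q') = f (chart_inv c q)"
    and x: "x \<in> carrier G" and y: "y \<in> carrier G"
  shows "f x = f y"
proof -
  have nbhd: "\<exists>V. openin T V \<and> z \<in> V \<and> (\<forall>z'\<in>V. f z' = f z)" if z: "z \<in> carrier G" for z
  proof -
    obtain c where c: "c \<in> A" "z \<in> dom_of c" using chart_exists[OF z] by blast
    obtain r where r: "r > 0" "\<forall>q'\<in>ball (crd c z) r \<inter> img_of c. f (chart_inv c q') = f z"
      using loc[OF c(1) crd_img[OF c(2)]] c by auto
    show ?thesis
    proof (intro exI conjI)
      show "openin T {w \<in> dom_of c. crd c w \<in> ball (crd c z) r}"
        by (rule open_image[OF c(1)]) simp
      show "z \<in> {w \<in> dom_of c. crd c w \<in> ball (crd c z) r}" using c r by simp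
      show "\<forall>z'\<in>{w \<in> dom_of c. crd c w \<in> ball (crd c z) r}. f z' = f z"
        using r(2) c by force
    qed
  qed
  have op: "openin T {z \<in> carrier G. P (f z)}" for P
  proof (subst openin_subopen, safe)
    fix z assume z: "z \<in> carrier G" "P (f z)"
    obtain V where V: "openin T V" "z \<in> V" "\<forall>z'\<in>V. f z' = f z" using nbhd[OF z(1)] by blast
    have "V \<subseteq> {z \<in> carrier G. P (f z)}"
    proof
      fix y assume y: "y \<in> V"
      then have "f y = f z" using V(3) by blast
      then show "y \<in> {z \<in> carrier G. P (f z)}"
        using y z(2) openin_subset[OF V(1)] topspace_eq by auto
    qed
    then show "\<exists>V. openin T V \<and> z \<in> V \<and> V \<subseteq> {z \<in> carrier G. P (f z)}" using V by blast
  qed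
  show ?thesis
  proof (rule ccontr)
    assume "f x \<noteq> f y"
    then have "{z \<in> carrier G. f z = f x} \<noteq> {}" "{z \<in> carrier G. f z \<noteq> f x} \<noteq> {}"
      using x y by auto
    moreover have "carrier G \<subseteq> {z \<in> carrier G. f z = f x} \<union> {z \<in> carrier G. f z \<noteq> f x}" by blast
    moreover have "{z \<in> carrier G. f z = f x} \<inter> {z \<in> carrier G. f z \<noteq> f x} = {}" by blast
    ultimately show False
      using conn op[of "\<lambda>u. u = f x"] op[of "\<lambda>u. u \<noteq> f x"]
      unfolding connected_space_def topspace_eq by blast
  qed
qed

text \<open>The multiplication in coordinates, with independent charts \<open>c\<close>, \<open>d\<close> for the two factors and \<open>c'\<close> for the product.
  The charts are kept apart because one factor will stay near the identity while the other
  factor and the product move in a chart elsewhere.\<close>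

definition mult_crd :: "('a, 'e) chart \<Rightarrow> ('a, 'e) chart \<Rightarrow> ('a, 'e) chart \<Rightarrow> 'e \<times> 'e \<Rightarrow> 'e" where
  "mult_crd c d c' z = crd c' (chart_inv c (fst z) \<otimes> chart_inv d (snd z))"

definition mult_dom :: "('a, 'e) chart \<Rightarrow> ('a, 'e) chart \<Rightarrow> ('a, 'e) chart \<Rightarrow> ('e \<times> 'e) set" where
  "mult_dom c d c' = {z \<in> img_of c \<times> img_of d. chart_inv c (fst z) \<otimes> chart_inv d (snd z) \<in> dom_of c'}"

lemma continuous_mult: "continuous_map (prod_topology T T) T (\<lambda>(x, y). x \<otimes> y)"
  using lie by (simp add: lie_group_def smooth_map_def)

lemma open_mult_dom:
  assumes c: "c \<in> A" and d: "d \<in> A" and c': "c' \<in> A"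
  shows "open (mult_dom c d c')"
proof -
  let ?X = "top_of_set (img_of c \<times> img_of d)"
  have X: "?X = prod_topology (top_of_set (img_of c)) (top_of_set (img_of d))"
    by (simp add: subtopology_Times[symmetric])
  have "continuous_map ?X T (\<lambda>z. chart_inv c (fst z))" "continuous_map ?X T (\<lambda>z. chart_inv d (snd z))"
    unfolding X
    by (rule continuous_map_compose[OF continuous_map_fst continuous_chart_inv[OF c], unfolded o_def]
        continuous_map_compose[OF continuous_map_snd continuous_chart_inv[OF d], unfolded o_def])+
  then have "continuous_map ?X (prod_topology T T) (\<lambda>z. (chart_inv c (fst z), chart_inv d (snd z)))"
    by (simp add: continuous_map_paired)
  from continuous_map_compose[OF this continuous_mult]
  have "continuous_map ?X T (\<lambda>z. chart_inv c (fst z) \<otimes> chart_inv d (snd z))"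
    by (simp add: o_def)
  from openin_continuous_map_preimage[OF this open_dom[OF c']]
  have "openin ?X (mult_dom c d c')" by (simp add: mult_dom_def)
  then show ?thesis
    using openin_open_trans open_Times[OF open_img[OF c] open_img[OF d]] by blast
qed

lemma smooth_mult:
  assumes c: "c \<in> A" and d: "d \<in> A" and c': "c' \<in> A"
  shows "k_smooth_on k (mult_dom c d c') (mult_crd c d c')"
proof -
  define cd where "cd = (dom_of c \<times> dom_of d, \<lambda>(x, y). (crd c x, crd d y))"
  have "cd \<in> prod_atlas A A" using c d by (auto simp: prod_atlas_def cd_def)
  then have sm: "k_smooth_on k (crd cd ` {z \<in> dom_of cd. (\<lambda>(x, y). x \<otimes> y) z \<in> dom_of c'})
      (local_rep cd c' (\<lambda>(x, y). x \<otimes> y))"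
    using lie c' by (auto simp: lie_group_def smooth_map_def smooth_on_def)
  have img: "crd cd ` {z \<in> dom_of cd. (\<lambda>(x, y). x \<otimes> y) z \<in> dom_of c'} = mult_dom c d c'" (is "?l = _")
  proof
    show "?l \<subseteq> mult_dom c d c'" using c d by (auto simp: cd_def mult_dom_def)
    show "mult_dom c d c' \<subseteq> ?l"
    proof
      fix z assume z: "z \<in> mult_dom c d c'"
      show "z \<in> ?l"
        by (rule image_eqI[of _ _ "(chart_inv c (fst z), chart_inv d (snd z))"])
          (use z c d in \<open>auto simp: cd_def mult_dom_def\<close>)
    qed
  qed
  have inj: "inj_on (crd cd) (dom_of cd)"
    using inj_chart[OF c] inj_chart[OF d] by (auto simp: cd_def inj_on_def)
  show ?thesis
  proof (rule k_smooth_on_cong[OF open_mult_dom[OF assms] _ sm[unfolded img]])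
    fix z assume z: "z \<in> mult_dom c d c'"
    have "chart_inv cd z = (chart_inv c (fst z), chart_inv d (snd z))"
      unfolding chart_inv_def[of cd]
      by (rule the_inv_into_f_eq[OF inj]) (use z c d in \<open>auto simp: cd_def mult_dom_def\<close>)
    then show "local_rep cd c' (\<lambda>(x, y). x \<otimes> y) z = mult_crd c d c' z"
      by (simp add: local_rep_def mult_crd_def)
  qed
qed

abbreviation dmult :: "('a, 'e) chart \<Rightarrow> ('a, 'e) chart \<Rightarrow> ('a, 'e) chart \<Rightarrow> 'e \<times> 'e \<Rightarrow> 'e \<times> 'e \<Rightarrow> 'e" where
  "dmult c d c' z \<equiv> frechet_derivative (mult_crd c d c') (at z)"

abbreviation ddmult where
  "ddmult c d c' z v \<equiv> frechet_derivative (\<lambda>z. dmult c d c' z v) (at z)"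

lemma has_derivative_mult:
  "c \<in> A \<Longrightarrow> d \<in> A \<Longrightarrow> c' \<in> A \<Longrightarrow> z \<in> mult_dom c d c' \<Longrightarrow>
    (mult_crd c d c' has_derivative dmult c d c' z) (at z)"
  using smooth_mult[of c d c' "Suc 0"] k_smooth_on_Suc_has_derivative by blast

lemma smooth_dmult:
  "c \<in> A \<Longrightarrow> d \<in> A \<Longrightarrow> c' \<in> A \<Longrightarrow> k_smooth_on k (mult_dom c d c') (\<lambda>z. dmult c d c' z v)"
  using smooth_mult[of c d c' "Suc k"] unfolding k_smooth_on.simps(2) by blast

lemma has_derivative_dmult:
  "c \<in> A \<Longrightarrow> d \<in> A \<Longrightarrow> c' \<in> A \<Longrightarrow> z \<in> mult_dom c d c' \<Longrightarrow>
    ((\<lambda>z. dmult c d c' z v) has_derivative ddmult c d c' z v) (at z)"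
  using smooth_dmult[of c d c' "Suc 0"] k_smooth_on_Suc_has_derivative by blast

lemma ddmult_symmetric:
  "c \<in> A \<Longrightarrow> d \<in> A \<Longrightarrow> c' \<in> A \<Longrightarrow> z \<in> mult_dom c d c' \<Longrightarrow> ddmult c d c' z v w = ddmult c d c' z w v"
  using second_derivative_symmetric[OF smooth_mult open_mult_dom] by blast

lemma linear_dmult:
  "c \<in> A \<Longrightarrow> d \<in> A \<Longrightarrow> c' \<in> A \<Longrightarrow> z \<in> mult_dom c d c' \<Longrightarrow> linear (dmult c d c' z)"
  using has_derivative_mult has_derivative_linear by blast

text \<open>A fixed chart at the identity. It is the chosen chart there, and not just any chart, because pushforwards
  read off the components of a vector in the chosen chart at its base point.\<close>

definition d\<^sub>0 :: "('a, 'e) chart" where "d\<^sub>0 = chart_at A \<one>"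

definition \<epsilon> :: 'e where "\<epsilon> = crd d\<^sub>0 \<one>"

lemma d0 [simp]: "d\<^sub>0 \<in> A" and one_d0 [simp]: "\<one> \<in> dom_of d\<^sub>0"
  using chart_at[OF one_closed] by (simp_all add: d\<^sub>0_def)

lemma eps_img [simp]: "\<epsilon> \<in> img_of d\<^sub>0" and chart_inv_eps [simp]: "chart_inv d\<^sub>0 \<epsilon> = \<one>"
  by (simp_all add: \<epsilon>_def)

lemma mult_dom_eps [simp]:
  assumes "c \<in> A" "q \<in> img_of c"
  shows "(q, \<epsilon>) \<in> mult_dom c d\<^sub>0 c" "(\<epsilon>, q) \<in> mult_dom d\<^sub>0 c c"
    "mult_crd c d\<^sub>0 c (q, \<epsilon>) = q" "mult_crd d\<^sub>0 c c (\<epsilon>, q) = q"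
  using assms by (simp_all add: mult_dom_def mult_crd_def)

lemma mult_crd_img: "z \<in> mult_dom c d c' \<Longrightarrow> mult_crd c d c' z \<in> img_of c'"
  by (simp add: mult_dom_def mult_crd_def)

lemma mult_dom_slices:
  assumes "c \<in> A" "d \<in> A" "c' \<in> A"
  shows "open {q. (q, u) \<in> mult_dom c d c'}" "open {u. (q, u) \<in> mult_dom c d c'}"
proof -
  have "open ((\<lambda>q. (q, u)) -` mult_dom c d c')" "open ((\<lambda>u. (q, u)) -` mult_dom c d c')"
    by (rule open_vimage[OF open_mult_dom[OF assms]], intro continuous_intros)+
  then show "open {q. (q, u) \<in> mult_dom c d c'}" "open {u. (q, u) \<in> mult_dom c d c'}"
    by (simp_all add: vimage_def)
qed

text \<open>The derivative at the identity of the left translation by the point \<open>q\<close>, that is, the left-invariant field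
  with value \<open>a\<close> at the identity; likewise on the right.\<close>

definition left_field :: "('a, 'e) chart \<Rightarrow> 'e \<Rightarrow> 'e \<Rightarrow> 'e" where
  "left_field c q a = dmult c d\<^sub>0 c (q, \<epsilon>) (0, a)"

definition right_field :: "('a, 'e) chart \<Rightarrow> 'e \<Rightarrow> 'e \<Rightarrow> 'e" where
  "right_field c q a = dmult d\<^sub>0 c c (\<epsilon>, q) (a, 0)"

text \<open>The Lie bracket of the left-invariant fields at the identity, where they have the values \<open>a\<close> and \<open>b\<close>.\<close>

definition structure_bracket :: "'e \<Rightarrow> 'e \<Rightarrow> 'e" where
  "structure_bracket a b = frechet_derivative (\<lambda>q. left_field d\<^sub>0 q b) (at \<epsilon>) a
    - frechet_derivative (\<lambda>q. left_field d\<^sub>0 q a) (at \<epsilon>) b"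

lemma has_derivative_left_field:
  assumes "c \<in> A" "q \<in> img_of c"
  shows "((\<lambda>q. left_field c q a) has_derivative (\<lambda>v. ddmult c d\<^sub>0 c (q, \<epsilon>) (0, a) (v, 0))) (at q)"
  unfolding left_field_def
  by (rule has_derivative_slices(1)[OF has_derivative_dmult]) (use assms in simp_all)

lemma has_derivative_right_field:
  assumes "c \<in> A" "q \<in> img_of c"
  shows "((\<lambda>q. right_field c q a) has_derivative (\<lambda>v. ddmult d\<^sub>0 c c (\<epsilon>, q) (a, 0) (0, v))) (at q)"
  unfolding right_field_def
  by (rule has_derivative_slices(2)[OF has_derivative_dmult]) (use assms in simp_all)

lemma has_derivative_left_translate:
  assumes "c \<in> A" "q \<in> img_of c"
  shows "((\<lambda>u. mult_crd c d\<^sub>0 c (q, u)) has_derivative left_field c q) (at \<epsilon>)"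
  unfolding left_field_def[abs_def]
  by (rule has_derivative_slices(2)[OF has_derivative_mult]) (use assms in simp_all)

lemma has_derivative_right_translate:
  assumes "c \<in> A" "q \<in> img_of c"
  shows "((\<lambda>u. mult_crd d\<^sub>0 c c (u, q)) has_derivative right_field c q) (at \<epsilon>)"
  unfolding right_field_def[abs_def]
  by (rule has_derivative_slices(1)[OF has_derivative_mult]) (use assms in simp_all)

lemma linear_left_field: "c \<in> A \<Longrightarrow> q \<in> img_of c \<Longrightarrow> linear (left_field c q)"
  and linear_right_field: "c \<in> A \<Longrightarrow> q \<in> img_of c \<Longrightarrow> linear (right_field c q)"
proof -
  assume c: "c \<in> A" and q: "q \<in> img_of c"
  have "linear (\<lambda>x::'e. (0::'e, x))" "linear (\<lambda>x::'e. (x, 0::'e))" by (intro linearI; simp)+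
  from linear_compose[OF this(1) linear_dmult[OF c d0 c]] linear_compose[OF this(2) linear_dmult[OF d0 c c]]
  show "linear (left_field c q)" "linear (right_field c q)"
    using c q by (simp_all add: o_def left_field_def[abs_def] right_field_def[abs_def])
qed

lemma left_field_at_one: "left_field d\<^sub>0 \<epsilon> a = a"
proof -
  have "((\<lambda>u. mult_crd d\<^sub>0 d\<^sub>0 d\<^sub>0 (\<epsilon>, u)) has_derivative (\<lambda>a. a)) (at \<epsilon>)"
    by (rule has_derivative_transform_within_open[OF has_derivative_ident open_img[OF d0] eps_img]) simp
  then show ?thesis
    using has_derivative_unique[OF has_derivative_left_translate[OF d0 eps_img]] by metis
qed

lemma mult_assoc_crd:
  assumes A: "c \<in> A" "d \<in> A" "c' \<in> A" "d' \<in> A" "b \<in> A" "b' \<in> A"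
    and 1: "(x, y) \<in> mult_dom c d c'" and 2: "(y, z) \<in> mult_dom d d' b"
    and z: "z \<in> img_of d'"
  shows "mult_crd c' d' b' (mult_crd c d c' (x, y), z) = mult_crd c b b' (x, mult_crd d d' b (y, z))"
  using assms by (auto simp: mult_crd_def mult_dom_def m_assoc)

text \<open>The derivative with respect to \<open>u\<close>, at the identity, of \<open>u (q w) = (u q) w\<close>. The next lemma does the same for
  \<open>(q w) u = q (w u)\<close>.\<close>

lemma right_field_mult:
  assumes c: "c \<in> A" and q: "q \<in> img_of c" and w: "(q, w) \<in> mult_dom c d\<^sub>0 c"
  shows "right_field c (mult_crd c d\<^sub>0 c (q, w)) b = dmult c d\<^sub>0 c (q, w) (right_field c q b, 0)"
proof -
  let ?U = "{u. (u, q) \<in> mult_dom d\<^sub>0 c c}"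
  have U: "open ?U" "\<epsilon> \<in> ?U" using mult_dom_slices(1)[OF d0 c c] c q by simp_all
  have "((\<lambda>u. mult_crd d\<^sub>0 c c (u, mult_crd c d\<^sub>0 c (q, w))) has_derivative
      (\<lambda>b. right_field c (mult_crd c d\<^sub>0 c (q, w)) b)) (at \<epsilon>)"
    by (rule has_derivative_right_translate[OF c mult_crd_img[OF w]])
  moreover have "((\<lambda>u. mult_crd d\<^sub>0 c c (u, mult_crd c d\<^sub>0 c (q, w))) has_derivative
      (\<lambda>b. dmult c d\<^sub>0 c (q, w) (right_field c q b, 0))) (at \<epsilon>)"
  proof (rule has_derivative_transform_within_open[OF _ U])
    have "((\<lambda>u. mult_crd d\<^sub>0 c c (u, q)) has_derivative (\<lambda>b. right_field c q b)) (at \<epsilon>)"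
      by (rule has_derivative_right_translate[OF c q])
    from diff_chain_at[OF this, of "\<lambda>y. mult_crd c d\<^sub>0 c (y, w)"
        "\<lambda>v. dmult c d\<^sub>0 c (q, w) (v, 0)"]
    show "((\<lambda>u. mult_crd c d\<^sub>0 c (mult_crd d\<^sub>0 c c (u, q), w)) has_derivative
      (\<lambda>b. dmult c d\<^sub>0 c (q, w) (right_field c q b, 0))) (at \<epsilon>)"
      using c q w has_derivative_slices(1)[OF has_derivative_mult[OF c d0 c w]]
      by (simp add: o_def)
    fix u assume "u \<in> ?U"
    then show "mult_crd c d\<^sub>0 c (mult_crd d\<^sub>0 c c (u, q), w) = mult_crd d\<^sub>0 c c (u, mult_crd c d\<^sub>0 c (q, w))"
      using c w by (intro mult_assoc_crd) (auto simp: mult_dom_def)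
  qed
  ultimately show ?thesis using has_derivative_unique by metis
qed

lemma left_field_mult:
  assumes c: "c \<in> A" and q: "q \<in> img_of c" and w: "(q, w) \<in> mult_dom c d\<^sub>0 c"
  shows "left_field c (mult_crd c d\<^sub>0 c (q, w)) b = dmult c d\<^sub>0 c (q, w) (0, left_field d\<^sub>0 w b)"
proof -
  have wi: "w \<in> img_of d\<^sub>0" using w by (simp add: mult_dom_def)
  let ?U = "{u. (w, u) \<in> mult_dom d\<^sub>0 d\<^sub>0 d\<^sub>0}"
  have U: "open ?U" "\<epsilon> \<in> ?U" using mult_dom_slices(2)[OF d0 d0 d0] wi by simp_all
  have "((\<lambda>u. mult_crd c d\<^sub>0 c (mult_crd c d\<^sub>0 c (q, w), u)) has_derivative
      (\<lambda>b. left_field c (mult_crd c d\<^sub>0 c (q, w)) b)) (at \<epsilon>)"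
    by (rule has_derivative_left_translate[OF c mult_crd_img[OF w]])
  moreover have "((\<lambda>u. mult_crd c d\<^sub>0 c (mult_crd c d\<^sub>0 c (q, w), u)) has_derivative
      (\<lambda>b. dmult c d\<^sub>0 c (q, w) (0, left_field d\<^sub>0 w b))) (at \<epsilon>)"
  proof (rule has_derivative_transform_within_open[OF _ U])
    have "((\<lambda>u. mult_crd d\<^sub>0 d\<^sub>0 d\<^sub>0 (w, u)) has_derivative (\<lambda>b. left_field d\<^sub>0 w b)) (at \<epsilon>)"
      by (rule has_derivative_left_translate[OF d0 wi])
    from diff_chain_at[OF this, of "\<lambda>y. mult_crd c d\<^sub>0 c (q, y)"
        "\<lambda>v. dmult c d\<^sub>0 c (q, w) (0, v)"]
    show "((\<lambda>u. mult_crd c d\<^sub>0 c (q, mult_crd d\<^sub>0 d\<^sub>0 d\<^sub>0 (w, u))) has_derivative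
      (\<lambda>b. dmult c d\<^sub>0 c (q, w) (0, left_field d\<^sub>0 w b))) (at \<epsilon>)"
      using wi has_derivative_slices(2)[OF has_derivative_mult[OF c d0 c w]]
      by (simp add: o_def)
    fix u assume "u \<in> ?U"
    then show "mult_crd c d\<^sub>0 c (q, mult_crd d\<^sub>0 d\<^sub>0 d\<^sub>0 (w, u)) = mult_crd c d\<^sub>0 c (mult_crd c d\<^sub>0 c (q, w), u)"
      using c w by (intro mult_assoc_crd[symmetric]) (auto simp: mult_dom_def)
  qed
  ultimately show ?thesis using has_derivative_unique by metis
qed

lemma has_derivative_field_along_mult:
  assumes c: "c \<in> A" and q: "q \<in> img_of c"
    and X: "(X has_derivative X') (at q)"
  shows "((\<lambda>w. X (mult_crd c d\<^sub>0 c (q, w))) has_derivative (\<lambda>a. X' (left_field c q a))) (at \<epsilon>)"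
proof -
  from diff_chain_at[OF has_derivative_left_translate[OF c q], of X X'] X c q show ?thesis by (simp add: o_def)
qed

text \<open>Differentiating the preceding identity for right-invariant fields with respect to \<open>w\<close>, at the identity,
  gives two mixed second derivatives of the multiplication, which agree by Schwarz's theorem.\<close>

lemma fields_commute:
  assumes c: "c \<in> A" and q: "q \<in> img_of c"
  shows "frechet_derivative (\<lambda>q. left_field c q a) (at q) (right_field c q b)
       = frechet_derivative (\<lambda>q. right_field c q b) (at q) (left_field c q a)"
proof -
  let ?W = "{w. (q, w) \<in> mult_dom c d\<^sub>0 c}"
  have W: "open ?W" "\<epsilon> \<in> ?W" using mult_dom_slices(2)[OF c d0 c] c q by simp_all
  have dR: "((\<lambda>q. right_field c q b) has_derivative frechet_derivative (\<lambda>q. right_field c q b) (at q)) (at q)"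
    using has_derivative_right_field[OF c q] frechet_derivative_works differentiable_def by blast
  have "((\<lambda>w. right_field c (mult_crd c d\<^sub>0 c (q, w)) b) has_derivative
      (\<lambda>a. ddmult c d\<^sub>0 c (q, \<epsilon>) (right_field c q b, 0) (0, a))) (at \<epsilon>)"
  proof (rule has_derivative_transform_within_open[OF _ W])
    show "((\<lambda>w. dmult c d\<^sub>0 c (q, w) (right_field c q b, 0)) has_derivative
      (\<lambda>a. ddmult c d\<^sub>0 c (q, \<epsilon>) (right_field c q b, 0) (0, a))) (at \<epsilon>)"
      by (intro has_derivative_slices(2) has_derivative_dmult) (use c q in simp_all)
  qed (simp add: right_field_mult[OF c q])
  with has_derivative_field_along_mult[OF c q dR]
  have "frechet_derivative (\<lambda>q. right_field c q b) (at q) (left_field c q a)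
      = ddmult c d\<^sub>0 c (q, \<epsilon>) (right_field c q b, 0) (0, a)"
    using has_derivative_unique by metis
  also have "\<dots> = ddmult c d\<^sub>0 c (q, \<epsilon>) (0, a) (right_field c q b, 0)"
    by (rule ddmult_symmetric) (use c q in simp_all)
  also have "\<dots> = frechet_derivative (\<lambda>q. left_field c q a) (at q) (right_field c q b)"
    using frechet_derivative_at[OF has_derivative_left_field[OF c q]] by metis
  finally show ?thesis by simp
qed

text \<open>Differentiating \<open>left_field_mult\<close> with respect to \<open>w\<close>, at the identity, expresses the derivative of one
  left-invariant field along another as a symmetric second derivative of the multiplication plus a
  left-invariant field; the bracket retains the latter only.\<close>

lemma left_fields_bracket:
  assumes c: "c \<in> A" and q: "q \<in> img_of c"
  shows "frechet_derivative (\<lambda>q. left_field c q b) (at q) (left_field c q a)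
       - frechet_derivative (\<lambda>q. left_field c q a) (at q) (left_field c q b)
       = left_field c q (structure_bracket a b)"
proof -
  let ?W = "{w. (q, w) \<in> mult_dom c d\<^sub>0 c}"
  have W: "open ?W" "\<epsilon> \<in> ?W" using mult_dom_slices(2)[OF c d0 c] c q by simp_all
  have z: "(q, \<epsilon>) \<in> mult_dom c d\<^sub>0 c" using c q by simp
  obtain B :: "'e set" where B: "finite B" "span B = UNIV" using finite_dim by blast
  let ?D = "\<lambda>b. frechet_derivative (\<lambda>q. left_field d\<^sub>0 q b) (at \<epsilon>)"
  have *: "frechet_derivative (\<lambda>q. left_field c q b) (at q) (left_field c q a)
      = ddmult c d\<^sub>0 c (q, \<epsilon>) (0, b) (0, a) + left_field c q (?D b a)" for a b
  proof -
    have dL: "((\<lambda>q. left_field c q b) has_derivative frechet_derivative (\<lambda>q. left_field c q b) (at q)) (at q)"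
      if "c \<in> A" "q \<in> img_of c" for c q
      using has_derivative_left_field[OF that] frechet_derivative_works differentiable_def by blast
    have "((\<lambda>w. left_field c (mult_crd c d\<^sub>0 c (q, w)) b) has_derivative
      (\<lambda>a. ddmult c d\<^sub>0 c (q, \<epsilon>) (0, left_field d\<^sub>0 \<epsilon> b) (0, a) + dmult c d\<^sub>0 c (q, \<epsilon>) (0, ?D b a))) (at \<epsilon>)"
    proof (rule has_derivative_transform_within_open[OF _ W])
      show "((\<lambda>w. dmult c d\<^sub>0 c (q, w) (0, left_field d\<^sub>0 w b)) has_derivative
        (\<lambda>a. ddmult c d\<^sub>0 c (q, \<epsilon>) (0, left_field d\<^sub>0 \<epsilon> b) (0, a) + dmult c d\<^sub>0 c (q, \<epsilon>) (0, ?D b a))) (at \<epsilon>)"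
      proof (rule has_derivative_linear_family[where F = "\<lambda>w x. dmult c d\<^sub>0 c (q, w) (0, x)", OF B _ W _ dL])
        show "linear (\<lambda>x. dmult c d\<^sub>0 c (q, w) (0, x))" if "w \<in> ?W" for w
        proof -
          have "linear (\<lambda>x::'e. (0::'e, x))" by (intro linearI) simp_all
          from linear_compose[OF this linear_dmult[OF c d0 c]] that show ?thesis
            by (simp add: o_def)
        qed
        show "((\<lambda>w. dmult c d\<^sub>0 c (q, w) (0, x)) has_derivative
          (\<lambda>a. ddmult c d\<^sub>0 c (q, \<epsilon>) (0, x) (0, a))) (at \<epsilon>)" for x
          by (intro has_derivative_slices(2) has_derivative_dmult) (use c q in simp_all)
      qed simp_all
    qed (simp add: left_field_mult[OF c q])
    from fun_cong[OF has_derivative_unique[OF has_derivative_field_along_mult[OF c q dL[OF c q]] this], of a]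
    show ?thesis unfolding left_field_at_one by (simp only: left_field_def)
  qed
  show ?thesis
    unfolding * structure_bracket_def linear_diff[OF linear_left_field[OF c q]]
      ddmult_symmetric[OF c d0 c z, of "(0, b)" "(0, a)"] by simp
qed

lemma commuting_frames_in_chart:
  assumes c: "c \<in> A"
  shows "commuting_frames (img_of c) (left_field c) (right_field c) structure_bracket"
proof (rule commuting_frames.intro)
  show "\<exists>B::'e set. finite B \<and> span B = UNIV" by (rule finite_dim)
  show "open (img_of c)" by (rule open_img[OF c])
  show "k_smooth_on 2 (img_of c) (\<lambda>q. left_field c q a)" for a
  proof -
    have "k_smooth_on 2 {q. (q, \<epsilon>) \<in> mult_dom c d\<^sub>0 c} (\<lambda>q. dmult c d\<^sub>0 c (q, \<epsilon>) (0, a))"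
      by (rule k_smooth_on_slice[OF open_mult_dom smooth_dmult]) (use c in simp_all)
    moreover have "{q. (q, \<epsilon>) \<in> mult_dom c d\<^sub>0 c} = img_of c"
      using c by (auto simp: mult_dom_def)
    ultimately show ?thesis by (simp add: left_field_def)
  qed
  fix q assume q: "q \<in> img_of c"
  show "linear (left_field c q)" "linear (right_field c q)"
    using linear_left_field linear_right_field c q by blast+
  show "(\<lambda>q. right_field c q a) differentiable at q" for a
    using has_derivative_right_field[OF c q] differentiable_def by blast
qed (use fields_commute left_fields_bracket c in blast)+

lemma has_derivative_transition:
  assumes "c \<in> A" "d \<in> A" "x \<in> dom_of c" "x \<in> dom_of d"
  shows "(local_rep c d id has_derivative frechet_derivative (local_rep c d id) (at (crd c x))) (at (crd c x))"
proof -
  have "k_smooth_on (Suc 0) (crd c ` (dom_of c \<inter> dom_of d)) (local_rep c d id)"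
    using lie assms by (simp add: lie_group_def smooth_manifold_def smooth_on_def del: k_smooth_on.simps)
  from k_smooth_on_Suc_has_derivative[OF this] show ?thesis using assms by blast
qed

lemma open_overlap:
  assumes "c \<in> A" "openin T S"
  shows "open (crd c ` (dom_of c \<inter> S))"
proof -
  have "crd c ` (dom_of c \<inter> S) = {q \<in> img_of c. chart_inv c q \<in> S}"
    using assms(1) by (force simp: img_of_def)
  then show ?thesis using open_preimage[OF assms] by simp
qed

lemma tangent_vec_self:
  assumes c: "c \<in> A" "x \<in> dom_of c" shows "tangent_vec A c x a c = a"
proof -
  have "(local_rep c c id has_derivative (\<lambda>v. v)) (at (crd c x))"
    by (rule has_derivative_transform_within_open[OF has_derivative_ident open_img[OF c(1)] crd_img[OF c(2)]])
      (simp add: local_rep_def c)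
  then show ?thesis using c by (simp add: tangent_vec_def frechet_derivative_at[symmetric])
qed

lemma tangent_vec_in_tangent_space:
  assumes c: "c \<in> A" "x \<in> dom_of c" shows "tangent_vec A c x a \<in> tangent_space A x"
proof -
  have "frechet_derivative (local_rep c d' id) (at (crd c x)) a =
      frechet_derivative (local_rep d d' id) (at (crd d x)) (frechet_derivative (local_rep c d id) (at (crd c x)) a)"
    if d: "d \<in> A" "x \<in> dom_of d" and d': "d' \<in> A" "x \<in> dom_of d'" for d d'
  proof -
    have x: "local_rep c d id (crd c x) = crd d x" using c by (simp add: local_rep_def)
    have "(local_rep d d' id \<circ> local_rep c d id has_derivative
        frechet_derivative (local_rep d d' id) (at (crd d x)) \<circ> frechet_derivative (local_rep c d id) (at (crd c x)))
        (at (crd c x))"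
      using diff_chain_at[OF has_derivative_transition[OF c(1) d(1) c(2) d(2)], unfolded x,
          OF has_derivative_transition[OF d(1) d'(1) d(2) d'(2)]] .
    then have "(local_rep c d' id has_derivative
        frechet_derivative (local_rep d d' id) (at (crd d x)) \<circ> frechet_derivative (local_rep c d id) (at (crd c x)))
        (at (crd c x))"
      by (rule has_derivative_transform_within_open[OF _ open_overlap[OF c(1) open_dom[OF d(1)]]])
        (use c d in \<open>auto simp: local_rep_def\<close>)
    then show ?thesis by (metis comp_apply frechet_derivative_at)
  qed
  note * = this
  have "tangent_vec A c x a d' = frechet_derivative (local_rep d d' id) (at (crd d x)) (tangent_vec A c x a d)"
    if "d \<in> A" "d' \<in> A" "x \<in> dom_of d \<and> x \<in> dom_of d'" for d d'
    using that *[of d d'] by (simp only: tangent_vec_def simp_thms if_True)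
  moreover have "tangent_vec A c x a d = 0" if "\<not> (d \<in> A \<and> x \<in> dom_of d)" for d
    using that by (simp only: tangent_vec_def if_False)
  ultimately show ?thesis unfolding tangent_space_def by blast
qed

lemma tangent_vec_component:
  assumes c: "c \<in> A" "x \<in> dom_of c" and v: "v \<in> tangent_space A x"
  shows "tangent_vec A c x (v c) = v"
proof
  fix d
  show "tangent_vec A c x (v c) d = v d"
  proof (cases "d \<in> A \<and> x \<in> dom_of d")
    case True
    then have "v d = frechet_derivative (local_rep c d id) (at (crd c x)) (v c)"
      using c v unfolding tangent_space_def by blast
    then show ?thesis using True by (simp only: tangent_vec_def simp_thms if_True)
  next
    case False
    then have "v d = 0" using v unfolding tangent_space_def by blast
    then show ?thesis using False by (simp only: tangent_vec_def if_False)
  qed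
qed

text \<open>Links the coordinate fields to the invariance hypotheses: the invariant fields are the pushforwards of
  the tangent vectors at the identity under translations.\<close>

lemma pushforward_translation:
  assumes c: "c \<in> A" and q: "q \<in> img_of c"
  shows pushforward_left_translation:
    "pushforward A (\<lambda>y. chart_inv c q \<otimes> y) \<one> (tangent_vec A d\<^sub>0 \<one> a)
      = tangent_vec A c (chart_inv c q) (left_field c q a)"
    and pushforward_right_translation:
    "pushforward A (\<lambda>y. y \<otimes> chart_inv c q) \<one> (tangent_vec A d\<^sub>0 \<one> a)
      = tangent_vec A c (chart_inv c q) (right_field c q a)"
proof -
  define x where "x = chart_inv c q"
  have x: "x \<in> dom_of c" "x \<in> carrier G" "crd c x = q" using c q by (simp_all add: x_def)
  have "frechet_derivative (local_rep d\<^sub>0 d f) (at \<epsilon>) a = frechet_derivative (local_rep c d id) (at q) (F a)"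
    if d: "d \<in> A" "x \<in> dom_of d" and m: "(m has_derivative F) (at \<epsilon>)" "m \<epsilon> = q"
      and U: "open U" "\<epsilon> \<in> U" "\<And>u. u \<in> U \<Longrightarrow> f (chart_inv d\<^sub>0 u) \<in> dom_of c \<and> m u = crd c (f (chart_inv d\<^sub>0 u))"
    for d f m F U
  proof -
    have "(local_rep c d id \<circ> m has_derivative frechet_derivative (local_rep c d id) (at q) \<circ> F) (at \<epsilon>)"
      using diff_chain_at[OF m(1), unfolded m(2)] has_derivative_transition[OF c d(1) x(1) d(2)] x(3) by metis
    then have "(local_rep d\<^sub>0 d f has_derivative frechet_derivative (local_rep c d id) (at q) \<circ> F) (at \<epsilon>)"
      by (rule has_derivative_transform_within_open[OF _ U(1,2)])
        (use U(3) c in \<open>auto simp: local_rep_def\<close>)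
    then show ?thesis by (metis comp_apply frechet_derivative_at)
  qed
  note * = this
  have l: "frechet_derivative (local_rep d\<^sub>0 d (\<lambda>y. x \<otimes> y)) (at \<epsilon>) a
      = frechet_derivative (local_rep c d id) (at q) (left_field c q a)" if d: "d \<in> A" "x \<in> dom_of d" for d
    by (rule *[OF d has_derivative_left_translate[OF c q] _ mult_dom_slices(2)[OF c d0 c, of q]])
      (use c q in \<open>auto simp: mult_dom_def mult_crd_def x_def\<close>)
  have r: "frechet_derivative (local_rep d\<^sub>0 d (\<lambda>y. y \<otimes> x)) (at \<epsilon>) a
      = frechet_derivative (local_rep c d id) (at q) (right_field c q a)" if d: "d \<in> A" "x \<in> dom_of d" for d
    by (rule *[OF d has_derivative_right_translate[OF c q] _ mult_dom_slices(1)[OF d0 c c, of q]])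
      (use c q in \<open>auto simp: mult_dom_def mult_crd_def x_def\<close>)
  show "pushforward A (\<lambda>y. chart_inv c q \<otimes> y) \<one> (tangent_vec A d\<^sub>0 \<one> a)
      = tangent_vec A c (chart_inv c q) (left_field c q a)"
    "pushforward A (\<lambda>y. y \<otimes> chart_inv c q) \<one> (tangent_vec A d\<^sub>0 \<one> a)
      = tangent_vec A c (chart_inv c q) (right_field c q a)"
    unfolding x_def[symmetric] pushforward_def d\<^sub>0_def[symmetric] tangent_vec_self[OF d0 one_d0]
    unfolding \<epsilon>_def[symmetric]
    using x l r by (auto simp: tangent_vec_def)
qed

lemma local_tensor_eq: "local_tensor A t c q a b =
    t (chart_inv c q) (tangent_vec A c (chart_inv c q) a) (tangent_vec A c (chart_inv c q) b)"
  by (simp add: local_tensor_def Let_def)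

lemma local_tensor_fields:
  assumes "bi_invariant G A t" "c \<in> A" "q \<in> img_of c"
  shows "local_tensor A t c q (left_field c q a) (left_field c q b)
      = t \<one> (tangent_vec A d\<^sub>0 \<one> a) (tangent_vec A d\<^sub>0 \<one> b)"
    "local_tensor A t c q (right_field c q a) (right_field c q b)
      = t \<one> (tangent_vec A d\<^sub>0 \<one> a) (tangent_vec A d\<^sub>0 \<one> b)"
proof -
  let ?x = "chart_inv c q"
  have x: "?x \<in> carrier G" using assms by simp
  then have "preserves A (\<lambda>y. ?x \<otimes> y) t" "preserves A (\<lambda>y. y \<otimes> ?x) t"
    using assms(1) by (auto simp: bi_invariant_def)
  moreover have "\<one> \<in> points A" using one_closed carrier_eq_points by blast
  ultimately show "local_tensor A t c q (left_field c q a) (left_field c q b)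
      = t \<one> (tangent_vec A d\<^sub>0 \<one> a) (tangent_vec A d\<^sub>0 \<one> b)"
    "local_tensor A t c q (right_field c q a) (right_field c q b)
      = t \<one> (tangent_vec A d\<^sub>0 \<one> a) (tangent_vec A d\<^sub>0 \<one> b)"
    using tangent_vec_in_tangent_space[OF d0 one_d0] x
    by (auto simp: preserves_def local_tensor_eq pushforward_translation[OF assms(2,3), symmetric])
qed

text \<open>The common value \<open>\<eta>\<close> is the tensor at the identity, pulled back to the model space by the chart there.\<close>

lemma invariant_local_tensor:
  assumes c: "c \<in> A" and t: "bi_invariant G A t" "smooth_tensor A t"
  shows "commuting_frames.invariant_tensor (img_of c) (left_field c) (right_field c) (local_tensor A t c)"
proof -
  interpret commuting_frames "img_of c" "left_field c" "right_field c" structure_bracket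
    by (rule commuting_frames_in_chart[OF c])
  have "k_smooth_on (Suc 0) (img_of c) (\<lambda>p. local_tensor A t c p a b)" for a b
    using t(2) c by (simp add: smooth_tensor_def smooth_on_def del: k_smooth_on.simps)
  then have "\<forall>q\<in>img_of c. \<forall>a b. (\<lambda>p. local_tensor A t c p a b) differentiable at q" by simp
  moreover have "\<forall>p\<in>img_of c. bilinear (local_tensor A t c p)"
    using t(2) c by (simp add: smooth_tensor_def)
  ultimately show ?thesis
    unfolding invariant_tensor_def using local_tensor_fields[OF t(1) c]
    by (intro conjI exI[of _ "\<lambda>a b. t \<one> (tangent_vec A d\<^sub>0 \<one> a) (tangent_vec A d\<^sub>0 \<one> b)"]) auto
qed

lemma tensor_component:
  assumes c: "c \<in> A" "x \<in> dom_of c" and v: "v \<in> tangent_space A x" "w \<in> tangent_space A x"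
  shows "t x v w = local_tensor A t c (crd c x) (v c) (w c)"
  using assms by (simp add: local_tensor_eq tangent_vec_component)

lemma local_metric:
  assumes c: "c \<in> A" and q: "q \<in> img_of c" and g: "riemannian_metric A g"
  shows "local_tensor A g c q a b = local_tensor A g c q b a"
    and "a \<noteq> 0 \<Longrightarrow> local_tensor A g c q a a > 0"
proof -
  let ?x = "chart_inv c q"
  have x: "?x \<in> points A" "?x \<in> dom_of c" using c q carrier_eq_points chart_inv_carrier by auto
  note tv = tangent_vec_in_tangent_space[OF c x(2)]
  show "local_tensor A g c q a b = local_tensor A g c q b a"
    using g x(1) tv by (simp add: riemannian_metric_def local_tensor_eq)
  assume "a \<noteq> 0"
  then have "tangent_vec A c ?x a \<noteq> (\<lambda>_. 0)" using tangent_vec_self[OF c x(2), of a] by metis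
  then show "local_tensor A g c q a a > 0"
    using g x(1) tv by (simp add: riemannian_metric_def local_tensor_eq)
qed

lemma biinvariant_metric_in_chart:
  assumes c: "c \<in> A" and g: "riemannian_metric A g" "bi_invariant G A g"
  shows "biinvariant_metric (img_of c) (left_field c) (right_field c) structure_bracket (local_tensor A g c)"
proof -
  interpret commuting_frames "img_of c" "left_field c" "right_field c" structure_bracket
    by (rule commuting_frames_in_chart[OF c])
  have sm: "smooth_tensor A g" using g(1) by (simp add: riemannian_metric_def)
  have pos1: "g \<one> (tangent_vec A d\<^sub>0 \<one> a) (tangent_vec A d\<^sub>0 \<one> a) > 0" if "a \<noteq> 0" for a
    using local_metric(2)[OF d0 eps_img g(1) that] by (simp add: local_tensor_eq)
  have inj: "inj F" if "linear F" "\<And>a. local_tensor A g c q (F a) (F a)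
      = g \<one> (tangent_vec A d\<^sub>0 \<one> a) (tangent_vec A d\<^sub>0 \<one> a)" "q \<in> img_of c" for F q
  proof -
    have "bilinear (local_tensor A g c q)" using sm c that(3) by (simp add: smooth_tensor_def)
    then have "a = 0" if "F a = 0" for a
      using pos1[of a] \<open>\<And>a. local_tensor A g c q (F a) (F a) = _\<close>[of a] that
      by (metis bilinear_lzero less_irrefl)
    then show ?thesis using linear_injective_0[OF that(1)] by blast
  qed
  show ?thesis
  proof (intro biinvariant_metric.intro biinvariant_metric_axioms.intro)
    show "commuting_frames (img_of c) (left_field c) (right_field c) structure_bracket"
      by (rule commuting_frames_in_chart[OF c])
    show "invariant_tensor (local_tensor A g c)" by (rule invariant_local_tensor[OF c g(2) sm])
    fix q assume q: "q \<in> img_of c"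
    show "local_tensor A g c q a b = local_tensor A g c q b a" for a b
      by (rule local_metric(1)[OF c q g(1)])
    show "0 < local_tensor A g c q a a" if "a \<noteq> 0" for a
      by (rule local_metric(2)[OF c q g(1) that])
    show "inj (left_field c q)" "inj (right_field c q)"
      using inj[OF linear_L[OF q] local_tensor_fields(1)[OF g(2) c q] q]
        inj[OF linear_N[OF q] local_tensor_fields(2)[OF g(2) c q] q] by blast+
  qed
qed

end

context lie_group_with_charts
begin

lemma right_field_at_one: "right_field d\<^sub>0 \<epsilon> a = a"
proof -
  have "((\<lambda>u. mult_crd d\<^sub>0 d\<^sub>0 d\<^sub>0 (u, \<epsilon>)) has_derivative (\<lambda>a. a)) (at \<epsilon>)"
    by (rule has_derivative_transform_within_open[OF has_derivative_ident open_img[OF d0] eps_img]) simp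
  then show ?thesis
    using has_derivative_unique[OF has_derivative_right_translate[OF d0 eps_img]] by metis
qed

section \<open>Vanishing bracket and commutativity\<close>

lemma commutative_imp_fields_agree:
  assumes comm: "comm_group G" and c: "c \<in> A" and q: "q \<in> img_of c"
  shows "left_field c q a = right_field c q a"
proof -
  interpret comm_group G by (rule comm)
  have "((\<lambda>u. mult_crd d\<^sub>0 c c (u, q)) has_derivative left_field c q) (at \<epsilon>)"
    by (rule has_derivative_transform_within_open[OF has_derivative_left_translate[OF c q] open_img[OF d0] eps_img])
      (use c q in \<open>simp add: mult_crd_def m_comm\<close>)
  then show ?thesis
    using has_derivative_unique[OF has_derivative_right_translate[OF c q]] by metis
qed

text \<open>The numbers \<open>g(a, Ad b)\<close> are globally defined functions of the point whose derivative vanishes in every chart;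
  on a connected group they keep their value at the identity, where \<open>Ad\<close> is trivial. Pairing with the metric avoids
  differentiating the adjoint representation itself.\<close>

lemma bracket_zero_imp_fields_agree:
  assumes conn: "connected_space T" and g: "riemannian_metric A g" "bi_invariant G A g"
    and K0: "\<And>a b. structure_bracket a b = 0" and c: "c \<in> A" and q: "q \<in> img_of c"
  shows "left_field c q b = right_field c q b"
proof -
  let ?tv = "tangent_vec A d\<^sub>0 \<one>"
  have pairing: "local_tensor A g c q (left_field c q a) (right_field c q b) = g \<one> (?tv a) (?tv b)" for a
  proof -
    \<comment> \<open>A description without charts, so that the value can be compared between charts.\<close>
    define f where "f = (\<lambda>x. g x (pushforward A (\<lambda>y. x \<otimes> y) \<one> (?tv a)) (pushforward A (\<lambda>y. y \<otimes> x) \<one> (?tv b)))"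
    have f: "f (chart_inv c q) = local_tensor A g c q (left_field c q a) (right_field c q b)"
      if "c \<in> A" "q \<in> img_of c" for c q
      using that by (simp add: f_def pushforward_translation local_tensor_eq)
    have "f (chart_inv c q) = f \<one>"
    proof (rule locally_constant_imp_constant[OF conn])
      fix c q assume c: "c \<in> A" and q: "q \<in> img_of c"
      interpret biinvariant_metric "img_of c" "left_field c" "right_field c" structure_bracket "local_tensor A g c"
        by (rule biinvariant_metric_in_chart[OF c g])
      obtain r where r: "r > 0" "ball q r \<subseteq> img_of c"
        using open_U q open_contains_ball by metis
      have "local_tensor A g c q' (left_field c q' a) (right_field c q' b)
          = local_tensor A g c q (left_field c q a) (right_field c q b)" if "q' \<in> ball q r" for q'
        using that r derivative_left_right_pairing[OF _ K0, of _ a b, THEN has_derivative_at_withinI]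
        by (intro has_derivative_zero_unique[of "ball q r"]) auto
      then show "\<exists>r>0. \<forall>q'\<in>ball q r \<inter> img_of c. f (chart_inv c q') = f (chart_inv c q)"
        using r(1) f[OF c] q by (metis IntE)
    qed (use c q in simp_all)
    then have "local_tensor A g c q (left_field c q a) (right_field c q b) = f (chart_inv d\<^sub>0 \<epsilon>)"
      using f[OF c q] by simp
    then show ?thesis
      unfolding f[OF d0 eps_img] left_field_at_one right_field_at_one by (simp add: local_tensor_eq)
  qed
  interpret biinvariant_metric "img_of c" "left_field c" "right_field c" structure_bracket "local_tensor A g c"
    by (rule biinvariant_metric_in_chart[OF c g])
  show ?thesis
  proof (rule h_eqI[OF q])
    fix z
    obtain a where z: "z = left_field c q a" using surj_L[OF q] by (rule surjE)
    show "local_tensor A g c q (left_field c q b) z = local_tensor A g c q (right_field c q b) z"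
      unfolding z using pairing[of a] local_tensor_fields(1)[OF g(2) c q, of a b] sym_h[OF q] by metis
  qed
qed

lemma continuous_inv: "continuous_map T T (\<lambda>x. inv x)"
  using lie by (simp add: lie_group_def smooth_map_def)

lemma differentiable_inv:
  assumes c: "c \<in> A" "x \<in> dom_of c" and d: "d \<in> A" "inv x \<in> dom_of d"
  shows "(\<lambda>q. crd d (inv (chart_inv c q))) differentiable (at (crd c x))"
proof -
  have "k_smooth_on (Suc 0) (crd c ` {x \<in> dom_of c. inv x \<in> dom_of d}) (local_rep c d (\<lambda>x. inv x))"
    using lie c d by (simp add: lie_group_def smooth_map_def smooth_on_def del: k_smooth_on.simps)
  from k_smooth_on_Suc_has_derivative[OF this, of "crd c x"] show ?thesis
    using c d by (auto simp: local_rep_def o_def differentiable_def)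
qed

lemma differentiable_conjugation:
  assumes k: "k \<in> carrier G" and c: "c \<in> A" "x \<in> dom_of c"
    and d: "d \<in> A" "inv x \<otimes> (k \<otimes> x) \<in> dom_of d"
  shows "(\<lambda>q. crd d (inv (chart_inv c q) \<otimes> (k \<otimes> chart_inv c q))) differentiable (at (crd c x))"
proof -
  have x: "x \<in> carrier G" using c dom_carrier by blast
  \<comment> \<open>Charts for the intermediate results of the products, so that the map is a composition of smooth ones.\<close>
  obtain b\<^sub>k where bk: "b\<^sub>k \<in> A" "k \<in> dom_of b\<^sub>k" using chart_exists[OF k] by blast
  obtain b where b: "b \<in> A" "inv x \<in> dom_of b" using chart_exists[of "inv x"] x by auto
  obtain b' where b': "b' \<in> A" "k \<otimes> x \<in> dom_of b'" using chart_exists[of "k \<otimes> x"] x k by auto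
  let ?p = "crd c x"
  let ?i = "\<lambda>q. crd b (inv (chart_inv c q))" and ?l = "\<lambda>q. mult_crd b\<^sub>k c b' (crd b\<^sub>k k, q)"
  obtain i' where i': "(?i has_derivative i') (at ?p)"
    using differentiable_inv[OF c b] unfolding differentiable_def by blast
  obtain l' where l': "(?l has_derivative l') (at ?p)"
    using has_derivative_slices(2)[OF has_derivative_mult[OF bk(1) c(1) b'(1)], of "crd b\<^sub>k k" ?p]
      c bk b' by (auto simp: mult_dom_def)
  have "((\<lambda>q. (?i q, ?l q)) has_derivative (\<lambda>v. (i' v, l' v))) (at ?p)"
    by (rule has_derivative_Pair[OF i' l'])
  moreover have "(?i ?p, ?l ?p) \<in> mult_dom b b' d"
    using b b' bk c d by (auto simp: mult_dom_def mult_crd_def)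
  ultimately have "(mult_crd b b' d \<circ> (\<lambda>q. (?i q, ?l q))) differentiable (at ?p)"
    using diff_chain_at has_derivative_mult[OF b(1) b'(1) d(1)] unfolding differentiable_def by blast
  then obtain F' where F': "(mult_crd b b' d \<circ> (\<lambda>q. (?i q, ?l q)) has_derivative F') (at ?p)"
    unfolding differentiable_def by blast
  have cont: "openin T {y \<in> topspace T. inv y \<in> dom_of b}" "openin T {y \<in> topspace T. k \<otimes> y \<in> dom_of b'}"
    using openin_continuous_map_preimage[OF continuous_inv open_dom[OF b(1)]]
      openin_continuous_map_preimage[OF continuous_map_compose[OF _ continuous_mult], of T "\<lambda>y. (k, y)" "dom_of b'"]
      open_dom[OF b'(1)] k by (simp_all add: o_def continuous_map_paired topspace_eq)
  let ?U = "{q \<in> img_of c. chart_inv c q \<in> {y \<in> topspace T. inv y \<in> dom_of b} \<inter> {y \<in> topspace T. k \<otimes> y \<in> dom_of b'}}"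
  have U: "open ?U" by (rule open_preimage[OF c(1) openin_Int[OF cont]])
  have "((\<lambda>q. crd d (inv (chart_inv c q) \<otimes> (k \<otimes> chart_inv c q))) has_derivative F') (at ?p)"
    by (rule has_derivative_transform_within_open[OF F' U])
      (use x c b b' bk topspace_eq in \<open>auto simp: mult_crd_def\<close>)
  then show ?thesis unfolding differentiable_def by blast
qed

lemma continuous_conjugation:
  assumes k: "k \<in> carrier G" shows "continuous_map T T (\<lambda>x. inv x \<otimes> (k \<otimes> x))"
proof -
  have "continuous_map T T (\<lambda>x. k \<otimes> x)"
    using continuous_map_compose[OF _ continuous_mult, of T "\<lambda>y. (k, y)"] k
    by (simp add: o_def continuous_map_paired topspace_eq)
  then have "continuous_map T (prod_topology T T) (\<lambda>x. (inv x, k \<otimes> x))"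
    using continuous_inv by (simp add: continuous_map_paired)
  from continuous_map_compose[OF this continuous_mult] show ?thesis by (simp add: o_def)
qed

text \<open>Let \<open>F x = x\<^sup>-\<^sup>1 k x\<close>. Differentiating \<open>w F(x w) = F(x) w\<close> with respect to \<open>w\<close>, at the identity, on the left yields the
  right-invariant field at \<open>F x\<close> plus the derivative of \<open>F\<close> in the direction of the left-invariant field at \<open>x\<close>, and on the right
  the left-invariant field at \<open>F x\<close>. If the two fields agree, the derivative of \<open>F\<close> is zero. Writing
  the equation without \<open>w\<^sup>-\<^sup>1\<close> avoids computing the derivative of the inversion.\<close>

lemma fields_agree_imp_conjugation_derivative_zero:
  assumes agree: "\<And>c q a. c \<in> A \<Longrightarrow> q \<in> img_of c \<Longrightarrow> left_field c q a = right_field c q a"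
    and surj: "\<And>c q. c \<in> A \<Longrightarrow> q \<in> img_of c \<Longrightarrow> surj (left_field c q)"
    and k: "k \<in> carrier G" and c: "c \<in> A" and q: "q \<in> img_of c"
    and d: "d \<in> A" "inv (chart_inv c q) \<otimes> (k \<otimes> chart_inv c q) \<in> dom_of d"
  shows "((\<lambda>q. crd d (inv (chart_inv c q) \<otimes> (k \<otimes> chart_inv c q))) has_derivative (\<lambda>v. 0)) (at q)"
proof -
  define F where "F = (\<lambda>x. inv x \<otimes> (k \<otimes> x))"
  define \<Phi> where "\<Phi> = (\<lambda>q. crd d (F (chart_inv c q)))"
  have Fc: "F x \<in> carrier G" if "x \<in> carrier G" for x using that k by (simp add: F_def)
  have \<Phi>q: "\<Phi> q \<in> img_of d" using d by (simp add: \<Phi>_def F_def)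
  obtain \<Phi>' where \<Phi>': "(\<Phi> has_derivative \<Phi>') (at q)"
    using differentiable_conjugation[OF k c chart_inv_dom[OF c q] d] c q
    by (auto simp: differentiable_def \<Phi>_def F_def)
  let ?m = "\<lambda>w. mult_crd c d\<^sub>0 c (q, w)"
  let ?S = "{q' \<in> img_of c. chart_inv c q' \<in> {x \<in> topspace T. F x \<in> dom_of d}}"
  have S: "open ?S"
    by (rule open_preimage[OF c openin_continuous_map_preimage[OF _ open_dom[OF d(1)]]])
      (use continuous_conjugation[OF k] in \<open>simp add: F_def\<close>)
  let ?W0 = "{w. (q, w) \<in> mult_dom c d\<^sub>0 c}"
  have W0: "open ?W0" "\<epsilon> \<in> ?W0" using mult_dom_slices(2)[OF c d0 c] c q by simp_all
  have "continuous_on ?W0 ?m"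
  proof (rule continuous_at_imp_continuous_on, rule ballI)
    fix w assume "w \<in> ?W0"
    then show "isCont ?m w"
      using has_derivative_continuous[OF has_derivative_slices(2)[OF has_derivative_mult[OF c d0 c]]] by blast
  qed
  from continuous_open_preimage[OF this W0(1) S]
  have W: "open (?W0 \<inter> ?m -` ?S)" .
  have \<epsilon>W: "\<epsilon> \<in> ?W0 \<inter> ?m -` ?S"
    using W0(2) c q d by (simp add: F_def topspace_eq)
  \<comment> \<open>The equation \<open>w F(q w) = F(q) w\<close>.\<close>
  have key: "mult_crd d\<^sub>0 d d (w, \<Phi> (?m w)) = mult_crd d d\<^sub>0 d (\<Phi> q, w)" if w: "w \<in> ?W0 \<inter> ?m -` ?S" for w
  proof -
    define x y where "x = chart_inv c q" and "y = chart_inv d\<^sub>0 w"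
    have wi: "w \<in> img_of d\<^sub>0" using w by (simp add: mult_dom_def)
    have xy: "x \<in> carrier G" "y \<in> carrier G" using c q wi by (simp_all add: x_def y_def)
    have m: "chart_inv c (?m w) = x \<otimes> y" using w c by (simp add: mult_dom_def mult_crd_def x_def y_def)
    have Fxy: "F (x \<otimes> y) \<in> dom_of d" using w m by auto
    have Fx: "F x \<in> dom_of d" using d by (simp add: F_def x_def)
    have "y \<otimes> F (x \<otimes> y) = F x \<otimes> y"
      using xy k by (simp add: F_def inv_mult_group m_assoc[symmetric])
    have "\<Phi> (?m w) = crd d (F (x \<otimes> y))" "\<Phi> q = crd d (F x)"
      by (simp_all only: \<Phi>_def m x_def)
    then show ?thesis
      using d(1) Fxy Fx \<open>y \<otimes> F (x \<otimes> y) = F x \<otimes> y\<close> by (simp add: mult_crd_def y_def)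
  qed
  have dm: "((\<lambda>w. \<Phi> (?m w)) has_derivative (\<lambda>a. \<Phi>' (left_field c q a))) (at \<epsilon>)"
    by (rule has_derivative_field_along_mult[OF c q \<Phi>'])
  let ?P = "dmult d\<^sub>0 d d (\<epsilon>, \<Phi> q)"
  have z: "(\<epsilon>, \<Phi> q) \<in> mult_dom d\<^sub>0 d d" using d \<Phi>q by simp
  have "((\<lambda>w. (w, \<Phi> (?m w))) has_derivative (\<lambda>a. (a, \<Phi>' (left_field c q a)))) (at \<epsilon>)"
    by (rule has_derivative_Pair[OF has_derivative_ident dm])
  from diff_chain_at[OF this, of "mult_crd d\<^sub>0 d d" ?P]
  have "((\<lambda>w. mult_crd d\<^sub>0 d d (w, \<Phi> (?m w))) has_derivative (\<lambda>a. ?P (a, \<Phi>' (left_field c q a)))) (at \<epsilon>)"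
    using has_derivative_mult[OF d0 d(1) d(1) z] c q by (simp add: o_def)
  then have "((\<lambda>w. mult_crd d d\<^sub>0 d (\<Phi> q, w)) has_derivative (\<lambda>a. ?P (a, \<Phi>' (left_field c q a)))) (at \<epsilon>)"
    by (rule has_derivative_transform_within_open[OF _ W \<epsilon>W key])
  from fun_cong[OF has_derivative_unique[OF this has_derivative_left_translate[OF d(1) \<Phi>q]]]
  have eq: "?P (a, \<Phi>' (left_field c q a)) = left_field d (\<Phi> q) a" for a .
  \<comment> \<open>Left multiplication by the identity does nothing.\<close>
  have id: "?P (0, v) = v" for v
  proof -
    have "((\<lambda>y. mult_crd d\<^sub>0 d d (\<epsilon>, y)) has_derivative (\<lambda>v. v)) (at (\<Phi> q))"
      by (rule has_derivative_transform_within_open[OF has_derivative_ident open_img[OF d(1)] \<Phi>q])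
        (use d in simp)
    from fun_cong[OF has_derivative_unique[OF has_derivative_slices(2)[OF has_derivative_mult[OF d0 d(1) d(1) z]] this]]
    show ?thesis .
  qed
  have "\<Phi>' v = 0" for v
  proof -
    obtain a where v: "v = left_field c q a" using surj[OF c q] by (rule surjE)
    have "?P (a, \<Phi>' v) = ?P (a, 0) + ?P (0, \<Phi>' v)"
      using linear_add[OF linear_dmult[OF d0 d(1) d(1) z], of "(a, 0)" "(0, \<Phi>' v)"] by simp
    then have "left_field d (\<Phi> q) a = right_field d (\<Phi> q) a + \<Phi>' v"
      using eq[of a] id v by (simp add: right_field_def)
    then show ?thesis using agree[OF d(1) \<Phi>q] by simp
  qed
  then have "\<Phi>' = (\<lambda>v. 0)" by blast
  then show ?thesis using \<Phi>' by (simp add: \<Phi>_def[abs_def] F_def)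
qed

text \<open>The map \<open>x \<mapsto> x\<^sup>-\<^sup>1 k x\<close> is constant because it is locally constant on a connected group, and its value at the
  identity is \<open>k\<close>.\<close>

lemma bracket_zero_imp_commutative:
  assumes conn: "connected_space T" and g: "riemannian_metric A g" "bi_invariant G A g"
    and K0: "\<And>a b. structure_bracket a b = 0"
  shows "comm_group G"
proof (rule group_comm_groupI)
  fix x k assume x: "x \<in> carrier G" and k: "k \<in> carrier G"
  define F where "F = (\<lambda>x. inv x \<otimes> (k \<otimes> x))"
  have surj: "surj (left_field c q)" if "c \<in> A" "q \<in> img_of c" for c q
    using biinvariant_metric.surj_L[OF biinvariant_metric_in_chart[OF that(1) g] that(2)] .
  have "F x = F \<one>"
  proof (rule locally_constant_imp_constant[OF conn _ x one_closed])
    fix c q assume c: "c \<in> A" and q: "q \<in> img_of c"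
    have "F (chart_inv c q) \<in> carrier G" using c q k by (simp add: F_def)
    then obtain d where d: "d \<in> A" "F (chart_inv c q) \<in> dom_of d" using chart_exists by blast
    let ?S = "{q' \<in> img_of c. chart_inv c q' \<in> {x \<in> topspace T. F x \<in> dom_of d}}"
    have S: "open ?S"
      by (rule open_preimage[OF c openin_continuous_map_preimage[OF _ open_dom[OF d(1)]]])
        (use continuous_conjugation[OF k] in \<open>simp add: F_def\<close>)
    moreover have "q \<in> ?S" using c q d by (simp add: topspace_eq)
    ultimately obtain r where r: "r > 0" "ball q r \<subseteq> ?S"
      by (rule openE)
    have "F (chart_inv c q') = F (chart_inv c q)" if q': "q' \<in> ball q r" for q'
    proof -
      have "((\<lambda>q. crd d (F (chart_inv c q))) has_derivative (\<lambda>v. 0)) (at y within ball q r)"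
        if "y \<in> ball q r" for y
        unfolding F_def
        by (rule has_derivative_at_withinI[OF fields_agree_imp_conjugation_derivative_zero
              [OF bracket_zero_imp_fields_agree[OF conn g K0] surj k c _ d(1)]])
          (use that r in \<open>auto simp: F_def\<close>)
      then have "crd d (F (chart_inv c q')) = crd d (F (chart_inv c q))"
        using q' r(1) by (intro has_derivative_zero_unique[of "ball q r"]) auto
      moreover have "F (chart_inv c q') \<in> dom_of d" using r(2) q' by auto
      ultimately show ?thesis using inj_onD[OF inj_chart[OF d(1)]] d(2) by blast
    qed
    then show "\<exists>r>0. \<forall>q'\<in>ball q r \<inter> img_of c. F (chart_inv c q') = F (chart_inv c q)"
      using r(1) by blast
  qed
  then have "inv x \<otimes> (k \<otimes> x) = k" using k by (simp add: F_def)
  then have "x \<otimes> (inv x \<otimes> (k \<otimes> x)) = x \<otimes> k" by simp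
  then have "k \<otimes> x = x \<otimes> k" using x k by (simp add: m_assoc[symmetric])
  then show "x \<otimes> k = k \<otimes> x" by simp
qed

end

section \<open>Magnetic sectional curvature of a bi-invariant system\<close>

locale bi_invariant_magnetic_lie_group = lie_group_with_charts G T A
  for G (structure) and T :: "'a topology" and A :: "('a, 'e::real_inner) chart set" +
  fixes g \<sigma> :: "('a, 'e) tensor2"
  assumes magnetic: "magnetic_system A g \<sigma>"
    and bi_invariant: "bi_invariant_system G A g \<sigma>"
begin

lemma metric: "riemannian_metric A g" "bi_invariant G A g"
  and form: "two_form A \<sigma>" "smooth_tensor A \<sigma>" "bi_invariant G A \<sigma>"
  using magnetic bi_invariant
  by (simp_all add: magnetic_system_def bi_invariant_system_def closed_two_form_def two_form_def)

lemma local_form_alternating: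
  assumes "c \<in> A" "q \<in> img_of c" shows "local_tensor A \<sigma> c q a a = 0"
proof -
  have "chart_inv c q \<in> points A" using assms carrier_eq_points chart_inv_carrier by metis
  then show ?thesis
    using form(1) tangent_vec_in_tangent_space[of c "chart_inv c q"] assms
    by (simp add: two_form_def local_tensor_eq)
qed

lemma local_geometry:
  assumes "c \<in> A"
  shows "biinvariant_metric (img_of c) (left_field c) (right_field c) structure_bracket (local_tensor A g c)"
  by (rule biinvariant_metric_in_chart[OF assms metric])

lemma magnetic_sec_eq:
  assumes x: "x \<in> carrier G" and on: "orthonormal_pair A g x v w"
  defines "c \<equiv> chart_at A x" and "p \<equiv> crd (chart_at A x) x"
  shows "magnetic_sec A g \<sigma> s x v w =
    s\<^sup>2 / 4 * local_tensor A g c p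
      (biinvariant_metric.lie_bracket_at (left_field c) structure_bracket p (v c) (w c))
      (biinvariant_metric.lie_bracket_at (left_field c) structure_bracket p (v c) (w c))
    + 3 / 4 * (local_tensor A \<sigma> c p (v c) (w c))\<^sup>2
    + 1 / 4 * local_tensor A g c p (lorentz (local_tensor A g c) (local_tensor A \<sigma> c) p (w c))
        (lorentz (local_tensor A g c) (local_tensor A \<sigma> c) p (w c))"
proof -
  have c: "c \<in> A" "x \<in> dom_of c" using chart_at[OF x] by (simp_all add: c_def)
  have p: "p \<in> img_of c" using c by (simp add: p_def c_def)
  interpret biinvariant_metric "img_of c" "left_field c" "right_field c" structure_bracket "local_tensor A g c"
    by (rule local_geometry[OF c(1)])
  have "local_tensor A g c p (v c) (v c) = 1" "local_tensor A g c p (w c) (w c) = 1"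
    "local_tensor A g c p (v c) (w c) = 0"
    using on tensor_component[OF c, of _ _ g] unfolding orthonormal_pair_def p_def c_def[symmetric] by metis+
  from magnetic_sectional_curvature[OF invariant_local_tensor[OF c(1) form(3,2)] local_form_alternating[OF c(1) p] p this]
  show ?thesis
    unfolding magnetic_sec_def Let_def c_def[symmetric] by (simp add: p_def c_def[symmetric])
qed

lemma magnetic_sec_nonneg:
  assumes x: "x \<in> carrier G" and on: "orthonormal_pair A g x v w"
  shows "magnetic_sec A g \<sigma> s x v w \<ge> 0"
proof -
  define c p where "c = chart_at A x" and "p = crd c x"
  have c: "c \<in> A" "x \<in> dom_of c" using chart_at[OF x] by (simp_all add: c_def)
  have p: "p \<in> img_of c" using c by (simp add: p_def)
  interpret biinvariant_metric "img_of c" "left_field c" "right_field c" structure_bracket "local_tensor A g c"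
    by (rule local_geometry[OF c(1)])
  show ?thesis
    unfolding magnetic_sec_eq[OF x on] c_def[symmetric] p_def[symmetric]
    by (intro add_nonneg_nonneg mult_nonneg_nonneg h_nonneg[OF p]) simp_all
qed

text \<open>One point suffices for the bracket, since the structure constants are the same everywhere. The squares
  vanish separately, for every orthonormal pair and hence for all pairs of vectors.\<close>

lemma magnetic_sec_zero_imp:
  assumes s: "s > 0" and zero: "\<And>v w. orthonormal_pair A g x v w \<Longrightarrow> magnetic_sec A g \<sigma> s x v w = 0"
    and x: "x \<in> carrier G"
  shows "structure_bracket a b = 0"
    and "v \<in> tangent_space A x \<Longrightarrow> w \<in> tangent_space A x \<Longrightarrow> \<sigma> x v w = 0"
proof -
  define c p where "c = chart_at A x" and "p = crd c x"
  have c: "c \<in> A" "x \<in> dom_of c" using chart_at[OF x] by (simp_all add: c_def)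
  have p: "p \<in> img_of c" using c by (simp add: p_def)
  have cp: "chart_inv c p = x" using c by (simp add: p_def)
  interpret biinvariant_metric "img_of c" "left_field c" "right_field c" structure_bracket "local_tensor A g c"
    by (rule local_geometry[OF c(1)])
  let ?h = "local_tensor A g c p" and ?\<tau> = "local_tensor A \<sigma> c p"
  have orth: "lie_bracket_at p v w = 0" "?\<tau> v w = 0"
    if "?h v v = 1" "?h w w = 1" "?h v w = 0" for v w
  proof -
    let ?v = "tangent_vec A c x v" and ?w = "tangent_vec A c x w"
    have on: "orthonormal_pair A g x ?v ?w"
      using that tangent_vec_in_tangent_space[OF c] by (simp add: orthonormal_pair_def local_tensor_eq cp)
    let ?a = "s\<^sup>2 / 4 * ?h (lie_bracket_at p v w) (lie_bracket_at p v w)"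
    let ?b = "3 / 4 * (?\<tau> v w)\<^sup>2"
    let ?c = "1 / 4 * ?h (lorentz (local_tensor A g c) (local_tensor A \<sigma> c) p w)
        (lorentz (local_tensor A g c) (local_tensor A \<sigma> c) p w)"
    have "?a + ?b + ?c = 0"
      using zero[OF on] magnetic_sec_eq[OF x on, of s] tangent_vec_self[OF c]
      by (simp flip: c_def p_def)
    moreover have "?a \<ge> 0" "?b \<ge> 0" "?c \<ge> 0" using h_nonneg[OF p] by simp_all
    ultimately have ab: "?a = 0" "?b = 0" by linarith+
    show "?\<tau> v w = 0" using ab(2) by simp
    have "?h (lie_bracket_at p v w) (lie_bracket_at p v w) = 0" using ab(1) s by simp
    then show "lie_bracket_at p v w = 0" using pos_h[OF p] by (metis less_irrefl)
  qed
  have "lie_bracket_at p (left_field c p a) (left_field c p b) = 0"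
    by (rule alternating_zero_if_zero_on_orthonormal[OF p lie_bracket_at_bilinear[OF p] lie_bracket_at_refl[OF p] orth(1)])
  then have "left_field c p (structure_bracket a b) = 0" using p by (simp add: lie_bracket_at_def)
  then show "structure_bracket a b = 0"
    using M_L[OF p, of "structure_bracket a b"] linear_0[OF linear_M[OF p]] by simp
  assume v: "v \<in> tangent_space A x" and w: "w \<in> tangent_space A x"
  have "bilinear ?\<tau>" using form(2) c p by (simp add: smooth_tensor_def)
  then have "?\<tau> (v c) (w c) = 0"
    by (rule alternating_zero_if_zero_on_orthonormal[OF p _ local_form_alternating[OF c(1) p] orth(2)])
  then show "\<sigma> x v w = 0" using tensor_component[OF c v w, of \<sigma>] by (simp add: p_def)
qed

lemma magnetic_sec_zero_if:
  assumes comm: "comm_group G"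
    and \<sigma>0: "\<And>v w. v \<in> tangent_space A x \<Longrightarrow> w \<in> tangent_space A x \<Longrightarrow> \<sigma> x v w = 0"
    and x: "x \<in> carrier G" and on: "orthonormal_pair A g x v w"
  shows "magnetic_sec A g \<sigma> s x v w = 0"
proof -
  define c p where "c = chart_at A x" and "p = crd c x"
  have c: "c \<in> A" "x \<in> dom_of c" using chart_at[OF x] by (simp_all add: c_def)
  have p: "p \<in> img_of c" using c by (simp add: p_def)
  interpret biinvariant_metric "img_of c" "left_field c" "right_field c" structure_bracket "local_tensor A g c"
    by (rule local_geometry[OF c(1)])
  have "structure_bracket a b = 0" for a b
    by (rule left_right_agree_imp_K_zero[OF p commutative_imp_fields_agree[OF comm c(1)]])
  then have br: "lie_bracket_at p a b = 0" for a b
    by (simp add: lie_bracket_at_def linear_0[OF linear_L[OF p]])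
  have \<tau>0: "local_tensor A \<sigma> c p a b = 0" for a b
    using \<sigma>0 tangent_vec_in_tangent_space[OF c] c by (simp add: local_tensor_eq p_def)
  have "lorentz (local_tensor A g c) (local_tensor A \<sigma> c) p a = 0" for a
    by (rule h_eqI[OF p])
      (simp add: lorentz_eq[OF invariant_local_tensor[OF c(1) form(3,2)] p] \<tau>0 bilinear_lzero[OF bilinear_h[OF p]])
  then show ?thesis
    unfolding magnetic_sec_eq[OF x on] c_def[symmetric] p_def[symmetric]
    by (simp add: br \<tau>0 bilinear_lzero[OF bilinear_h[OF p]])
qed

end

theorem theorem1:
  fixes G :: "('g, 'm) monoid_scheme"
    and T :: "'g topology"
    and A :: "('g, 'e::real_inner) chart set"
    and g \<sigma> :: "('g, 'e) tensor2"
    and s :: real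
  assumes "lie_group G T A"
    and "connected_space T"
    and "magnetic_system A g \<sigma>"
    and "bi_invariant_system G A g \<sigma>"
    and "s > 0"
  shows "(\<forall>x\<in>carrier G. \<forall>v w. orthonormal_pair A g x v w \<longrightarrow> magnetic_sec A g \<sigma> s x v w \<ge> 0) \<and>
    ((\<forall>x\<in>carrier G. \<forall>v w. orthonormal_pair A g x v w \<longrightarrow> magnetic_sec A g \<sigma> s x v w = 0) \<longleftrightarrow>
      comm_group G \<and>
      (\<forall>x\<in>carrier G. \<forall>v\<in>tangent_space A x. \<forall>w\<in>tangent_space A x. \<sigma> x v w = 0))"
proof -
  have "group G" using assms(1) by (simp add: lie_group_def)
  then interpret bi_invariant_magnetic_lie_group G T A g \<sigma>
    using assms
    by (simp add: bi_invariant_magnetic_lie_group_def bi_invariant_magnetic_lie_group_axioms_def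
        lie_group_with_charts_def lie_group_with_charts_axioms_def)
  show ?thesis
  proof (intro conjI iffI)
    show "\<forall>x\<in>carrier G. \<forall>v w. orthonormal_pair A g x v w \<longrightarrow> magnetic_sec A g \<sigma> s x v w \<ge> 0"
      using magnetic_sec_nonneg by blast
  next
    assume zero: "\<forall>x\<in>carrier G. \<forall>v w. orthonormal_pair A g x v w \<longrightarrow> magnetic_sec A g \<sigma> s x v w = 0"
    have "structure_bracket a b = 0" for a b
      using magnetic_sec_zero_imp(1)[OF assms(5) _ one_closed] zero by blast
    then show "comm_group G" by (rule bracket_zero_imp_commutative[OF assms(2) metric])
    show "\<forall>x\<in>carrier G. \<forall>v\<in>tangent_space A x. \<forall>w\<in>tangent_space A x. \<sigma> x v w = 0"
      using magnetic_sec_zero_imp(2)[OF assms(5)] zero by blast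
  next
    assume "comm_group G \<and> (\<forall>x\<in>carrier G. \<forall>v\<in>tangent_space A x. \<forall>w\<in>tangent_space A x. \<sigma> x v w = 0)"
    then show "\<forall>x\<in>carrier G. \<forall>v w. orthonormal_pair A g x v w \<longrightarrow> magnetic_sec A g \<sigma> s x v w = 0"
      using magnetic_sec_zero_if by blast
  qed
qed

end
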